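(* Consider the following algorithm, which receives $\epsilon>0$, $n=|V(G)|$ and random neighbour oracle access to a graph $G$ with $V(G)=[n]$. Set $\epsilon'=\epsilon/2$, $\alpha=8p^2/\epsilon'$, $\beta=8p^{16r^2\log r}/\epsilon'$, $\delta=2^{12}\beta^3 r$, $\xi_1=\lceil 20\alpha/\epsilon'\rceil$, $\xi_2=r^2+3r+1$, $\xi_3=\lceil 20r\delta\rceil$. Let $G_0$ be the graph with no edges whose vertex set consists of $\xi_1$ vertices of $V(G)$ chosen independently and uniformly at random. For $s=1,\dots,\xi_2$: let $G_s$ initially be a copy of $G_{s-1}$; for every $v\in V(G_{s-1})$, repeat $\xi_3$ times: query the oracle for a random neighbour $u$ of $v$ and add the vertex $u$ and the edge $vu$ to $G_s$. Finally, reject if $G_{\xi_2}$ has a subgraph isomorphic to $H$, and accept otherwise. Then: if $G$ is $H$-free, the algorithm accepts with probability $1$; if $G$ is $(p,r)$-admissible (i.e. $\mathrm{adm}_r(G)\le p$) and $\epsilon$-far from $H$-freeness, the algorithm rejects with probability at least $2/3$; and the number of oracle queries made by the algorithm is independent of $n$.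
   Context: Standing assumptions: $p,r\in\mathbb N$ with $p\ge 2$; $H$ is a fixed connected graph with at least two vertices, $|V(H)|\le r$, and $\mathrm{adm}_r(H)\le p$; the input graph $G$ satisfies $|V(G)|>2r$. $\log$ denotes the base-2 logarithm. All graphs are finite, simple and undirected. Admissibility: for a total order $\le$ on $V(G)$ and $v\in V(G)$, a path from $v$ to $x$ is admissible if $x<v$ and all internal vertices $w$ satisfy $w>v$; it is $r$-admissible if its length is at most $r$. An $r$-admissible path packing rooted at $v$ is a set of $r$-admissible paths starting at $v$ which are pairwise vertex-disjoint apart from $v$; $\mathrm{pp}^r(v)$ is the maximum size of one. $\mathrm{adm}_r$ of the ordered graph is $\max_v \mathrm{pp}^r(v)$, and $\mathrm{adm}_r(G)$ is the minimum of this over all total orders of $V(G)$. The random neighbour oracle answers a query $v$ with an independently and uniformly random neighbour of $v$. $G$ is $H$-free if it has no subgraph isomorphic to $H$, and $\epsilon$-far from $H$-freeness if at least $\epsilon|V(G)|$ edges must be added or removed to make it $H$-free. *)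

theory Defs
  imports "HOL-Probability.Probability"
begin

datatype 'a ugraph = UGraph (verts: "'a set") (edges: "'a set set")

definition simple_graph :: "'a ugraph \<Rightarrow> bool" where
  "simple_graph G \<longleftrightarrow>
     finite (verts G) \<and>
     edges G \<subseteq> {{u, v} | u v. u \<in> verts G \<and> v \<in> verts G \<and> u \<noteq> v}"

definition neighbours :: "'a ugraph \<Rightarrow> 'a \<Rightarrow> 'a set" where
  "neighbours G v = {u \<in> verts G. {v, u} \<in> edges G}"

text \<open>A path is given by its list of vertices; its length is the number of its edges,
  i.e. one less than the length of the list.\<close>

definition is_path :: "'a ugraph \<Rightarrow> 'a list \<Rightarrow> bool" where
  "is_path G xs \<longleftrightarrow>
     xs \<noteq> [] \<and> distinct xs \<and> set xs \<subseteq> verts G \<and>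
     (\<forall>i. Suc i < length xs \<longrightarrow> {xs ! i, xs ! Suc i} \<in> edges G)"

definition connected_graph :: "'a ugraph \<Rightarrow> bool" where
  "connected_graph G \<longleftrightarrow>
     verts G \<noteq> {} \<and>
     (\<forall>u\<in>verts G. \<forall>v\<in>verts G. \<exists>xs. is_path G xs \<and> hd xs = u \<and> last xs = v)"

definition subgraph :: "'a ugraph \<Rightarrow> 'a ugraph \<Rightarrow> bool" where
  "subgraph S G \<longleftrightarrow> simple_graph S \<and> verts S \<subseteq> verts G \<and> edges S \<subseteq> edges G"

definition isomorphic :: "'a ugraph \<Rightarrow> 'b ugraph \<Rightarrow> bool" where
  "isomorphic H S \<longleftrightarrow>
     (\<exists>f. bij_betw f (verts H) (verts S) \<and>
          (\<forall>u\<in>verts H. \<forall>v\<in>verts H. {u, v} \<in> edges H \<longleftrightarrow> {f u, f v} \<in> edges S))"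

definition contains_copy :: "'b ugraph \<Rightarrow> 'a ugraph \<Rightarrow> bool" where
  "contains_copy H G \<longleftrightarrow> (\<exists>S. subgraph S G \<and> isomorphic H S)"

definition free_of :: "'b ugraph \<Rightarrow> 'a ugraph \<Rightarrow> bool" where
  "free_of H G \<longleftrightarrow> \<not> contains_copy H G"

text \<open>Edge modifications keep the vertex set; turning \<open>G\<close> into \<open>G'\<close> requires adding or
  removing exactly the edges in the symmetric difference of the two edge sets.\<close>

definition far_from_free :: "real \<Rightarrow> 'b ugraph \<Rightarrow> 'a ugraph \<Rightarrow> bool" where
  "far_from_free \<epsilon> H G \<longleftrightarrow>
     (\<forall>G'. simple_graph G' \<and> verts G' = verts G \<and> free_of H G' \<longrightarrow>
        \<epsilon> * real (card (verts G)) \<le>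
          real (card ((edges G - edges G') \<union> (edges G' - edges G))))"

text \<open>A total order on the vertex set is a (reflexive) relation \<open>R\<close> with
  \<open>linear_order_on (verts G) R\<close>.\<close>

definition admissible_path ::
  "'a ugraph \<Rightarrow> ('a \<times> 'a) set \<Rightarrow> nat \<Rightarrow> 'a \<Rightarrow> 'a list \<Rightarrow> bool" where
  "admissible_path G R r v xs \<longleftrightarrow>
     is_path G xs \<and> hd xs = v \<and> length xs - 1 \<le> r \<and>
     (last xs, v) \<in> R \<and> last xs \<noteq> v \<and>
     (\<forall>w\<in>set (butlast (tl xs)). (v, w) \<in> R \<and> w \<noteq> v)"

definition path_packing ::
  "'a ugraph \<Rightarrow> ('a \<times> 'a) set \<Rightarrow> nat \<Rightarrow> 'a \<Rightarrow> 'a list set \<Rightarrow> bool" where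
  "path_packing G R r v P \<longleftrightarrow>
     (\<forall>xs\<in>P. admissible_path G R r v xs) \<and>
     (\<forall>xs\<in>P. \<forall>ys\<in>P. xs \<noteq> ys \<longrightarrow> set xs \<inter> set ys = {v})"

text \<open>The maxima and the minimum below are attained for every nonempty finite graph, see the
  lemmas following the definitions; on the graph without vertices they are junk values.\<close>

definition pp :: "'a ugraph \<Rightarrow> ('a \<times> 'a) set \<Rightarrow> nat \<Rightarrow> 'a \<Rightarrow> nat" where
  "pp G R r v = Max {card P | P. path_packing G R r v P}"

definition adm_ordered :: "nat \<Rightarrow> 'a ugraph \<Rightarrow> ('a \<times> 'a) set \<Rightarrow> nat" where
  "adm_ordered r G R = Max (pp G R r ` verts G)"

definition adm :: "nat \<Rightarrow> 'a ugraph \<Rightarrow> nat" where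
  "adm r G = Min {adm_ordered r G R | R. linear_order_on (verts G) R}"

lemma finite_path_packings:
  assumes "simple_graph G"
  shows "finite {P. path_packing G R r v P}"
proof (rule finite_subset)
  show "{P. path_packing G R r v P} \<subseteq> Pow {xs. set xs \<subseteq> verts G \<and> distinct xs}"
    by (auto simp: path_packing_def admissible_path_def is_path_def)
  show "finite (Pow {xs. set xs \<subseteq> verts G \<and> distinct xs})"
    using assms by (simp add: simple_graph_def finite_subset_distinct)
qed

lemma path_packing_empty: "path_packing G R r v {}"
  by (simp add: path_packing_def)

lemma finite_linear_orders:
  assumes "simple_graph G"
  shows "finite {R. linear_order_on (verts G) R}"
proof (rule finite_subset)
  show "{R. linear_order_on (verts G) R} \<subseteq> Pow (verts G \<times> verts G)"
    by (auto simp: order_on_defs)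
  show "finite (Pow (verts G \<times> verts G))"
    using assms by (simp add: simple_graph_def)
qed

lemma ex_linear_order: "\<exists>R. linear_order_on (verts G) R"
  using well_order_on[of "verts G"] by (auto simp: well_order_on_def)

text \<open>On an isolated vertex the oracle has nothing to return and answers \<open>None\<close>.\<close>

definition random_neighbour_oracle :: "'a ugraph \<Rightarrow> 'a \<Rightarrow> 'a option pmf" where
  "random_neighbour_oracle G v =
     (if neighbours G v = {} then return_pmf None
      else map_pmf Some (pmf_of_set (neighbours G v)))"

definition alpha_par :: "nat \<Rightarrow> real \<Rightarrow> real" where
  "alpha_par p \<epsilon> = 8 * real p ^ 2 / (\<epsilon> / 2)"

definition beta_par :: "nat \<Rightarrow> nat \<Rightarrow> real \<Rightarrow> real" where
  "beta_par p r \<epsilon> = 8 * real p powr (16 * real r ^ 2 * log 2 (real r)) / (\<epsilon> / 2)"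

definition delta_par :: "nat \<Rightarrow> nat \<Rightarrow> real \<Rightarrow> real" where
  "delta_par p r \<epsilon> = 2 ^ 12 * beta_par p r \<epsilon> ^ 3 * real r"

definition xi1 :: "nat \<Rightarrow> real \<Rightarrow> nat" where
  "xi1 p \<epsilon> = nat \<lceil>20 * alpha_par p \<epsilon> / (\<epsilon> / 2)\<rceil>"

definition xi2 :: "nat \<Rightarrow> nat" where
  "xi2 r = r ^ 2 + 3 * r + 1"

definition xi3 :: "nat \<Rightarrow> nat \<Rightarrow> real \<Rightarrow> nat" where
  "xi3 p r \<epsilon> = nat \<lceil>20 * real r * delta_par p r \<epsilon>\<rceil>"

text \<open>The state of the algorithm is the graph explored so far together with the number of
  oracle queries made so far. The argument \<open>orc\<close> is the only access to the input graph;
  every query draws a fresh independent answer.\<close>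

fun record_answer :: "'a \<Rightarrow> 'a option \<Rightarrow> 'a ugraph \<Rightarrow> 'a ugraph" where
  "record_answer v None K = K"
| "record_answer v (Some u) K = UGraph (insert u (verts K)) (insert {v, u} (edges K))"

definition query ::
  "('a \<Rightarrow> 'a option pmf) \<Rightarrow> 'a \<Rightarrow> 'a ugraph \<times> nat \<Rightarrow> ('a ugraph \<times> nat) pmf" where
  "query orc v st = do {
     ans \<leftarrow> orc v;
     return_pmf (record_answer v ans (fst st), Suc (snd st))
   }"

primrec query_list ::
  "('a \<Rightarrow> 'a option pmf) \<Rightarrow> 'a list \<Rightarrow> 'a ugraph \<times> nat \<Rightarrow> ('a ugraph \<times> nat) pmf" where
  "query_list orc [] st = return_pmf st"
| "query_list orc (v # vs) st = do {
     st' \<leftarrow> query orc v st;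
     query_list orc vs st'
   }"

text \<open>One round: the list of queried vertices is fixed by the graph at the beginning of the
  round, so vertices discovered during the round are not queried before the next one.\<close>

definition explore_round ::
  "(nat \<Rightarrow> nat option pmf) \<Rightarrow> nat \<Rightarrow> nat ugraph \<times> nat \<Rightarrow> (nat ugraph \<times> nat) pmf" where
  "explore_round orc k st =
     query_list orc (concat (map (replicate k) (sorted_list_of_set (verts (fst st))))) st"

primrec explore ::
  "(nat \<Rightarrow> nat option pmf) \<Rightarrow> nat \<Rightarrow> nat \<Rightarrow> nat ugraph \<times> nat \<Rightarrow> (nat ugraph \<times> nat) pmf" where
  "explore orc k 0 st = return_pmf st"
| "explore orc k (Suc s) st = do {
     st' \<leftarrow> explore orc k s st;
     explore_round orc k st'
   }"

datatype verdict = Accept | Reject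

definition tester ::
  "nat \<Rightarrow> nat \<Rightarrow> 'b ugraph \<Rightarrow> real \<Rightarrow> nat \<Rightarrow> (nat \<Rightarrow> nat option pmf) \<Rightarrow> (verdict \<times> nat) pmf" where
  "tester p r H \<epsilon> n orc = do {
     xs \<leftarrow> replicate_pmf (xi1 p \<epsilon>) (pmf_of_set {1..n});
     (K, q) \<leftarrow> explore orc (xi3 p r \<epsilon>) (xi2 r) (UGraph (set xs) {}, 0);
     return_pmf (if contains_copy H K then Reject else Accept, q)
   }"

end

theory Submission
  imports Defs
begin

text \<open>
  Fix an order witnessing admissibility. A vertex \<open>m\<close> is weakly reachable from \<open>v\<close> if a short walk from
  \<open>v\<close> to \<open>m\<close> stays above \<open>m\<close>; there are at most \<open>(1 + p r)^r\<close> such \<open>m\<close> for each \<open>v\<close>. Since the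
  degrees sum up to at most \<open>2 p n\<close>, one can remove \<open>\<epsilon> n / 2\<close> edges so that at every vertex \<open>h\<close>
  each relevant continuation (a walk to a weakly reachable or heavy vertex, or a way to attach a part of \<open>H\<close>
  with prescribed boundary) either disappears or starts with a constant fraction of the neighbours of
  \<open>h\<close>. A sampled vertex lies on a copy in the pruned graph with constant probability. From then on the
  discovered part of some copy grows: either one of its vertices reaches an undiscovered vertex of the
  copy through continuations that random queries find, or a random neighbour of a discovered vertex can replace
  an undiscovered vertex of the copy, after re-embedding the undiscovered component around it. At most \<open>r - 1\<close>
  such steps of \<open>r\<close> rounds each and one more round for the edges suffice.
\<close>

section \<open>Weak reachability in ordered graphs\<close>

text \<open>The obstacle is a vertex of large degree: no particular neighbour of it is a likely
  answer, so a copy fixed in advance cannot be traced through it. Pruning makes every surviving edge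
  easy to find from its upper end, because there the lower end is itself a target and the rule for
  no remaining step bounds the degree by \<open>\<delta>\<close>. What remains are edges leading
  upwards from vertices of large degree. There only a class of answers can be frequent, hence the
  re-embedding. The number of classes is independent of \<open>n\<close> because a component is
  attached at its highest boundary vertex, from which the whole boundary is weakly reachable. The
  danger of re-embedding is a collision with the rest of the copy; forbidding heavy vertices where
  the entry vertex weakly reaches them leaves only collisions through vertices that few neighbours
  reach. All continuations are defined monotonically in the edge set, so that no deletion revives
  one that was destroyed before, and the losses just add up.\<close>

text \<open>\<open>reach rk F m l\<close> consists of the vertices from which \<open>m\<close> is weakly \<open>l\<close>-reachable: those with an
  \<open>F\<close>-walk of length at most \<open>l\<close> to \<open>m\<close> on which \<open>m\<close> is the only vertex of least rank.\<close>

primrec reach :: "('a \<Rightarrow> nat) \<Rightarrow> 'a set set \<Rightarrow> 'a \<Rightarrow> nat \<Rightarrow> 'a set" where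
  "reach rk F m 0 = {m}"
| "reach rk F m (Suc l) =
     reach rk F m l \<union> {v. rk m < rk v \<and> (\<exists>x\<in>reach rk F m l. {v, x} \<in> F)}"

lemma reach_mono: "l \<le> l' \<Longrightarrow> F \<subseteq> F' \<Longrightarrow> reach rk F m l \<subseteq> reach rk F' m l'"
proof -
  assume F: "F \<subseteq> F'"
  have 1: "reach rk F m l \<subseteq> reach rk F' m l" for l
    using F by (induction l) auto
  assume "l \<le> l'"
  hence "reach rk F' m l \<subseteq> reach rk F' m l'"
    using lift_Suc_mono_le[of "reach rk F' m" l l'] by simp
  with 1 show ?thesis by blast
qed

lemma reachD_mono: "v \<in> reach rk F m l \<Longrightarrow> l \<le> l' \<Longrightarrow> F \<subseteq> F' \<Longrightarrow> v \<in> reach rk F' m l'"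
  using reach_mono[THEN subsetD] .

lemma reach_rank: "v \<in> reach rk F m l \<Longrightarrow> v = m \<or> rk m < rk v"
  by (induction l) auto

lemma walk_in_reach:
  assumes "successively (\<lambda>u v. {u, v} \<in> F) xs" "xs \<noteq> []"
    and "\<And>v. v \<in> set xs \<Longrightarrow> v = last xs \<or> rk (last xs) < rk v"
  shows "hd xs \<in> reach rk F (last xs) (length xs - 1)"
  using assms
proof (induction xs)
  case (Cons x xs)
  show ?case
  proof (cases "xs = []")
    case False
    have IH: "hd xs \<in> reach rk F (last xs) (length xs - 1)"
      using Cons False by (auto simp: successively_Cons)
    have len: "length xs = Suc (length xs - 1)" using False by (cases xs) auto
    have "x \<in> reach rk F (last xs) (Suc (length xs - 1))"
    \<comment> \<open>The walk may revisit its endpoint. A step of \<open>reach\<close> requires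
      strictly larger rank, so such a start is covered by the walk of length zero instead.\<close>
    proof (cases "x = last xs")
      case True
      have "last xs \<in> reach rk F (last xs) 0" by simp
      from reachD_mono[OF this] True show ?thesis by simp
    next
      case neq: False
      thus ?thesis using Cons.prems(1) Cons.prems(3)[of x] False IH
        unfolding reach.simps by (auto simp: successively_Cons)
    qed
    thus ?thesis using False by (cases xs) auto
  qed simp
qed simp

text \<open>Cut the walk at its lowest vertex: both pieces, the second one reversed, are walks on
  which this vertex is lowest. Hence the two ends share a weakly reachable vertex.\<close>

lemma walk_meet:
  assumes "successively (\<lambda>u v. {u, v} \<in> F) xs" "xs \<noteq> []" "inj_on rk (set xs)"
  shows "\<exists>m\<in>set xs. hd xs \<in> reach rk F m (length xs - 1) \<and> last xs \<in> reach rk F m (length xs - 1)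
           \<and> (\<forall>v\<in>set xs. rk m \<le> rk v)"
proof -
  obtain m where m: "m \<in> set xs" "\<forall>v\<in>set xs. rk m \<le> rk v"
    using ex_min_if_finite[of "rk ` set xs"] assms(2)
    by (metis List.finite_set arg_min_if_finite(1) arg_min_least set_empty)
  have above: "v = m \<or> rk m < rk v" if "v \<in> set xs" for v
    using m that assms(3) by (metis inj_on_eq_iff le_neq_implies_less)
  from m(1) obtain ys zs where xs: "xs = ys @ m # zs" by (auto simp: in_set_conv_decomp)
  have "hd (ys @ [m]) \<in> reach rk F (last (ys @ [m])) (length (ys @ [m]) - 1)"
    by (rule walk_in_reach) (use assms(1) above in \<open>auto simp: xs successively_append_iff successively_Cons\<close>)
  hence "hd xs \<in> reach rk F m (length ys)"
    by (cases ys) (auto simp: xs)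
  hence 1: "hd xs \<in> reach rk F m (length xs - 1)"
    by (rule reachD_mono) (auto simp: xs)
  have "hd (rev (m # zs)) \<in> reach rk F (last (rev (m # zs))) (length (rev (m # zs)) - 1)"
  proof (rule walk_in_reach)
    have "successively (\<lambda>u v. {u, v} \<in> F) (m # zs)"
      using assms(1) by (simp add: xs successively_append_iff)
    thus "successively (\<lambda>u v. {u, v} \<in> F) (rev (m # zs))"
      unfolding successively_rev by (simp add: insert_commute)
  qed (use above in \<open>auto simp: xs last_rev\<close>)
  hence "last xs \<in> reach rk F m (length zs)"
    by (simp add: xs hd_append hd_rev split: if_splits)
  hence "last xs \<in> reach rk F m (length xs - 1)"
    by (rule reachD_mono) (auto simp: xs)
  with 1 m show ?thesis by blast
qed

lemma is_path_conv:
  "is_path G xs \<longleftrightarrow> xs \<noteq> [] \<and> distinct xs \<and> set xs \<subseteq> verts G \<and>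
     successively (\<lambda>u v. {u, v} \<in> edges G) xs"
  by (auto simp: is_path_def successively_conv_nth)

lemma path_prefix: "is_path G (as @ bs) \<Longrightarrow> as \<noteq> [] \<Longrightarrow> is_path G as"
  by (simp add: is_path_conv successively_append_iff)

lemma path_extend:
  assumes "is_path G xs" "v \<in> verts G" "{v, hd xs} \<in> edges G"
  shows "\<exists>ys. is_path G ys \<and> hd ys = v \<and> last ys = last xs \<and> set ys \<subseteq> insert v (set xs) \<and>
           length ys \<le> Suc (length xs)"
proof (cases "v \<in> set xs")
  case True
  then obtain as bs where xs: "xs = as @ v # bs" by (auto simp: in_set_conv_decomp)
  show ?thesis
    by (rule exI[of _ "v # bs"]) (use assms in \<open>auto simp: xs is_path_conv successively_append_iff\<close>)
next
  case False
  show ?thesis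
    by (rule exI[of _ "v # xs"]) (use assms False in \<open>auto simp: is_path_conv successively_Cons\<close>)
qed

lemma simple_edge:
  assumes "simple_graph G" "{u, v} \<in> edges G"
  shows "u \<in> verts G" "v \<in> verts G" "u \<noteq> v"
  using assms by (auto simp: simple_graph_def doubleton_eq_iff dest!: subsetD)

lemma edge_endpoints:
  assumes "simple_graph G" "e \<in> edges G"
  obtains u v where "e = {u, v}" "u \<in> verts G" "v \<in> verts G" "u \<noteq> v"
  using assms unfolding simple_graph_def by blast

text \<open>\<open>reach\<close> contains \<open>m\<close> even if \<open>m\<close> is no vertex of
  the graph, so membership in the graph has to be tied to that of \<open>m\<close>.\<close>

lemma reach_in_verts:
  assumes "simple_graph G" "v \<in> reach rk (edges G) m l"
  shows "v \<in> verts G \<longleftrightarrow> m \<in> verts G"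
  using assms(2)
proof (induction l arbitrary: v)
  case (Suc l)
  then show ?case using simple_edge[OF assms(1)] by fastforce
qed simp

text \<open>A walk becomes a path by cutting off loops. This only drops vertices, so
  \<open>m\<close> stays lowest.\<close>

lemma path_of_reach:
  assumes G: "simple_graph G" and "v \<in> reach rk (edges G) m l" "v \<in> verts G"
  shows "\<exists>xs. is_path G xs \<and> hd xs = v \<and> last xs = m \<and> length xs \<le> Suc l \<and>
           (\<forall>w\<in>set xs. rk m \<le> rk w)"
  using assms(2,3)
proof (induction l arbitrary: v)
  case 0
  thus ?case by (intro exI[of _ "[m]"]) (auto simp: is_path_def)
next
  case (Suc l)
  show ?case
  proof (cases "v \<in> reach rk (edges G) m l")
    case True
    from Suc.IH[OF True Suc.prems(2)] show ?thesis using le_SucI by blast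
  next
    case False
    then obtain x where x: "rk m < rk v" "x \<in> reach rk (edges G) m l" "{v, x} \<in> edges G"
      using Suc.prems by auto
    from Suc.IH[OF x(2)] simple_edge[OF G x(3)] obtain xs where xs:
      "is_path G xs" "hd xs = x" "last xs = m" "length xs \<le> Suc l" "\<forall>w\<in>set xs. rk m \<le> rk w"
      by auto
    from path_extend[OF xs(1) Suc.prems(2)] x(3) xs(2) obtain ys where
      "is_path G ys" "hd ys = v" "last ys = last xs" "set ys \<subseteq> insert v (set xs)"
      "length ys \<le> Suc (length xs)" by auto
    with xs x(1) show ?thesis by (intro exI[of _ ys]) auto
  qed
qed

section \<open>Consequences of bounded path packings\<close>

definition back_neighbours :: "('a \<Rightarrow> nat) \<Rightarrow> 'a ugraph \<Rightarrow> 'a \<Rightarrow> 'a set" where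
  "back_neighbours rk G v = {u \<in> neighbours G v. rk u < rk v}"

text \<open>The ranks \<open>rk\<close> replace the order \<open>R\<close>, so that vertices can be compared by the linear arithmetic of
  natural numbers.\<close>

locale ordered_graph =
  fixes G :: "'a ugraph" and R :: "('a \<times> 'a) set" and rk :: "'a \<Rightarrow> nat" and p r :: nat
  assumes simple: "simple_graph G"
    and rk_inj: "inj_on rk (verts G)"
    and rk_order: "\<And>u v. u \<in> verts G \<Longrightarrow> v \<in> verts G \<Longrightarrow> (u, v) \<in> R \<longleftrightarrow> rk u \<le> rk v"
    and packing: "\<And>v P. v \<in> verts G \<Longrightarrow> path_packing G R r v P \<Longrightarrow> card P \<le> p"
    and r_pos: "r \<ge> 1"
begin

lemma finite_verts: "finite (verts G)"
  using simple by (simp add: simple_graph_def)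

text \<open>Such a path may go below its start before it ends. Stopping at the first vertex below
  the start, which exists because the end is one, yields an admissible path: everything in between
  is above the start.\<close>

lemma truncate_path:
  assumes "is_path G xs" "last xs \<noteq> hd xs" "\<forall>w\<in>set xs. rk (last xs) \<le> rk w" "length xs \<le> Suc r"
  shows "\<exists>ys. admissible_path G R r (hd xs) ys \<and> set ys \<subseteq> set xs"
proof -
  define v where "v = hd xs"
  obtain ts where xs: "xs = v # ts" using assms(1) by (cases xs) (auto simp: is_path_def v_def)
  have ts: "ts \<noteq> []" using assms(2) xs by auto
  have "rk (last xs) \<noteq> rk v"
    using inj_onD[OF rk_inj, of "last xs" "hd xs"] assms(1,2) hd_in_set[of xs] last_in_set[of xs]
    by (auto simp: is_path_def v_def simp del: hd_in_set last_in_set)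
  hence "\<exists>u\<in>set ts. rk u < rk v"
    using assms(3) ts xs by (intro bexI[of _ "last ts"]) auto
  then obtain as u bs where ts': "ts = as @ u # bs" "rk u < rk v" "\<forall>w\<in>set as. \<not> rk w < rk v"
    using split_list_first_propE[of ts "\<lambda>u. rk u < rk v"] by metis
  have sub: "set xs \<subseteq> verts G" using assms(1) by (simp add: is_path_def)
  have "(v, w) \<in> R" if "w \<in> set as" for w
  proof -
    have "w \<in> verts G" "v \<in> verts G" "\<not> rk w < rk v" using that ts' sub by (auto simp: xs)
    thus ?thesis using rk_order by simp
  qed
  moreover have "(u, v) \<in> R" "u \<noteq> v" using ts' sub rk_order[of u v] by (auto simp: xs)
  moreover have "is_path G (v # as @ [u])"
  proof -
    have "is_path G ((v # as @ [u]) @ bs)" using assms(1) by (simp add: xs ts')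
    thus ?thesis by (rule path_prefix) simp
  qed
  moreover have "v \<notin> set as"
  proof -
    have "distinct xs" using assms(1) by (simp add: is_path_def)
    thus ?thesis by (simp add: xs ts'(1))
  qed
  moreover have "length as + 1 \<le> r" using assms(4) by (simp add: xs ts'(1))
  ultimately have "admissible_path G R r v (v # as @ [u])"
    unfolding admissible_path_def by (auto simp: butlast_append)
  moreover have "set (v # as @ [u]) \<subseteq> set xs" by (auto simp: xs ts'(1))
  ultimately show ?thesis unfolding v_def[symmetric] by blast
qed

text \<open>Truncation keeps distinct paths distinct, since they share only \<open>v\<close> and
  each truncated path ends elsewhere.\<close>

lemma packing_bound:
  assumes v: "v \<in> verts G"
    and P: "\<And>xs. xs \<in> P \<Longrightarrow> is_path G xs \<and> hd xs = v \<and> last xs \<noteq> v \<and>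
            (\<forall>w\<in>set xs. rk (last xs) \<le> rk w) \<and> length xs \<le> Suc r"
    and disj: "\<And>xs ys. xs \<in> P \<Longrightarrow> ys \<in> P \<Longrightarrow> xs \<noteq> ys \<Longrightarrow> set xs \<inter> set ys = {v}"
  shows "card P \<le> p"
proof -
  have "\<forall>xs\<in>P. \<exists>ys. admissible_path G R r v ys \<and> set ys \<subseteq> set xs"
    using truncate_path P by metis
  then obtain t where t: "\<And>xs. xs \<in> P \<Longrightarrow> admissible_path G R r v (t xs) \<and> set (t xs) \<subseteq> set xs"
    by metis
  have tv: "v \<in> set (t xs)" "last (t xs) \<in> set (t xs)" "last (t xs) \<noteq> v" if "xs \<in> P" for xs
    using t[OF that] by (auto simp: admissible_path_def is_path_def)
  have "inj_on t P"
  proof (rule inj_onI, rule ccontr)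
    fix xs ys assume xy: "xs \<in> P" "ys \<in> P" "t xs = t ys" "xs \<noteq> ys"
    have "last (t xs) \<in> set xs \<inter> set ys" using t tv xy by (metis IntI subsetD)
    thus False using disj[OF xy(1,2,4)] tv[OF xy(1)] by auto
  qed
  moreover have "path_packing G R r v (t ` P)"
    unfolding path_packing_def
  proof (intro conjI ballI impI; clarify?)
    fix xs ys assume xy: "xs \<in> P" "ys \<in> P" "t xs \<noteq> t ys"
    hence "set xs \<inter> set ys = {v}" using disj by blast
    thus "set (t xs) \<inter> set (t ys) = {v}" using t xy tv by blast
  qed (use t in auto)
  ultimately show ?thesis using packing[OF v] card_image by metis
qed

lemma reached_finite: "v \<in> verts G \<Longrightarrow> finite {m. v \<in> reach rk (edges G) m l}"
  using reach_in_verts[OF simple] by (intro finite_subset[OF _ finite_verts]) auto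

text \<open>A maximal packing of paths from \<open>v\<close> to weakly reachable vertices truncates to a packing of admissible
  paths, so it covers at most \<open>p * r\<close> vertices besides \<open>v\<close>. Every further such path meets one of
  these vertices, from which the endpoint is weakly reachable in one step less.\<close>

lemma card_reached:
  "l \<le> r \<Longrightarrow> v \<in> verts G \<Longrightarrow> card {m. v \<in> reach rk (edges G) m l} \<le> (1 + p * r) ^ l"
proof (induction l arbitrary: v)
  case 0
  have "{m. v = m} = {v}" by auto
  thus ?case by simp
next
  case (Suc l)
  define C where "C = (\<lambda>v l. {m. v \<in> reach rk (edges G) m l})"
  define good where "good = (\<lambda>xs. is_path G xs \<and> hd xs = v \<and> last xs \<noteq> v \<and>
            (\<forall>w\<in>set xs. rk (last xs) \<le> rk w) \<and> length xs \<le> Suc (Suc l))"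
  define pk where "pk = (\<lambda>P. (\<forall>xs\<in>P. good xs) \<and>
     (\<forall>xs\<in>P. \<forall>ys\<in>P. xs \<noteq> ys \<longrightarrow> set xs \<inter> set ys = {v}))"
  have bound: "card P \<le> p" if "pk P" for P
    by (rule packing_bound[OF \<open>v \<in> verts G\<close>]) (use that \<open>Suc l \<le> r\<close> in \<open>auto simp: pk_def good_def\<close>)
  have "pk {}" by (simp add: pk_def)
  then obtain P where P: "pk P" "\<And>Q. pk Q \<Longrightarrow> card Q \<le> card P"
    using bound[THEN le_imp_less_Suc] ex_has_greatest_nat[of pk "{}" card "Suc p"] by auto
  have finP: "finite P"
  proof (rule finite_subset)
    show "P \<subseteq> {xs. set xs \<subseteq> verts G \<and> distinct xs}"
      using P(1) by (auto simp: pk_def good_def is_path_def)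
    show "finite {xs. set xs \<subseteq> verts G \<and> distinct xs}"
      using finite_verts by (simp add: finite_subset_distinct)
  qed
  define Y where "Y = (\<Union>xs\<in>P. set xs - {v})"
  have finY: "finite Y" using finP by (simp add: Y_def)
  have YV: "Y \<subseteq> verts G" using P(1) by (auto simp: Y_def pk_def good_def is_path_def)
  have "card Y \<le> (\<Sum>xs\<in>P. card (set xs - {v}))"
    unfolding Y_def by (rule card_UN_le[OF finP])
  also have "\<dots> \<le> (\<Sum>xs\<in>P. r)"
  proof (rule sum_mono)
    fix xs assume "xs \<in> P"
    hence g: "good xs" using P(1) by (simp add: pk_def)
    hence "v \<in> set xs" by (auto simp: good_def is_path_def)
    moreover have "card (set xs) \<le> Suc r"
      using g card_length[of xs] \<open>Suc l \<le> r\<close> by (auto simp: good_def)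
    ultimately show "card (set xs - {v}) \<le> r" by simp
  qed
  also have "\<dots> \<le> p * r" using bound[OF P(1)] by simp
  finally have cY: "card Y \<le> p * r" .
  have sub: "C v (Suc l) \<subseteq> {v} \<union> (\<Union>y\<in>Y. C y l)"
  proof
    fix m assume m: "m \<in> C v (Suc l)"
    show "m \<in> {v} \<union> (\<Union>y\<in>Y. C y l)"
    proof (cases "m = v")
      case False
      from path_of_reach[OF simple _ \<open>v \<in> verts G\<close>] m obtain xs where xs:
        "is_path G xs" "hd xs = v" "last xs = m" "length xs \<le> Suc (Suc l)"
        "\<forall>w\<in>set xs. rk m \<le> rk w" unfolding C_def by blast
      have g: "good xs" using xs False by (auto simp: good_def)
      have vx: "v \<in> set xs" "m \<in> set xs" using xs by (auto simp: is_path_def)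
      have "set xs \<inter> Y \<noteq> {}"
      proof
        assume e: "set xs \<inter> Y = {}"
        have "xs \<notin> P" using e vx False by (auto simp: Y_def)
        moreover have "pk (insert xs P)"
          unfolding pk_def
        proof (intro conjI ballI impI)
          fix as bs assume ab: "as \<in> insert xs P" "bs \<in> insert xs P" "as \<noteq> bs"
          have "set xs \<inter> set cs = {v}" if "cs \<in> P" for cs
          proof -
            have "good cs" using that P(1) by (simp add: pk_def)
            hence "v \<in> set cs" by (auto simp: good_def is_path_def)
            thus ?thesis using e vx that by (auto simp: Y_def)
          qed
          moreover have "set as \<inter> set bs = {v}" if "as \<in> P" "bs \<in> P"
            using that ab(3) P(1) unfolding pk_def by blast
          ultimately show "set as \<inter> set bs = {v}" using ab by (auto simp: Int_commute)
        qed (use g P(1) in \<open>auto simp: pk_def\<close>)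
        ultimately show False using P(2)[of "insert xs P"] finP by simp
      qed
      then obtain y where y: "y \<in> set xs" "y \<in> Y" by blast
      hence yv: "y \<noteq> v" by (auto simp: Y_def)
      from y(1) obtain as bs where ab: "xs = as @ y # bs" by (auto simp: in_set_conv_decomp)
      have "as \<noteq> []" using ab xs(2) yv by auto
      have V: "set xs \<subseteq> verts G" using xs(1) by (simp add: is_path_def)
      have "y \<in> reach rk (edges G) m (length (y # bs) - 1)"
      proof -
        have "last (y # bs) = m" using xs(3) ab by simp
        moreover have "w = m \<or> rk m < rk w" if "w \<in> set (y # bs)" for w
          using xs(5) that V vx(2) inj_onD[OF rk_inj, of w m] ab
          by (metis UnI2 le_neq_implies_less set_append subset_iff)
        moreover have "successively (\<lambda>u v. {u, v} \<in> edges G) (y # bs)"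
          using xs(1) by (simp add: ab is_path_conv successively_append_iff)
        ultimately show ?thesis using walk_in_reach[of "edges G" "y # bs" rk] by simp
      qed
      moreover have "length (y # bs) - 1 \<le> l" using ab xs(4) \<open>as \<noteq> []\<close> by (cases as) auto
      ultimately have "y \<in> reach rk (edges G) m l" by (meson order_refl reachD_mono)
      thus ?thesis using y by (auto simp: C_def)
    qed simp
  qed
  have fin: "finite (C y l)" if "y \<in> verts G" for y using that reached_finite by (simp add: C_def)
  have "card (C v (Suc l)) \<le> card ({v} \<union> (\<Union>y\<in>Y. C y l))"
    by (rule card_mono[OF _ sub]) (use finY YV fin in auto)
  also have "\<dots> \<le> 1 + card (\<Union>y\<in>Y. C y l)"
    by (rule order_trans[OF card_Un_le]) simp
  also have "card (\<Union>y\<in>Y. C y l) \<le> (\<Sum>y\<in>Y. card (C y l))" by (rule card_UN_le[OF finY])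
  also have "\<dots> \<le> (\<Sum>y\<in>Y. (1 + p * r) ^ l)"
    by (rule sum_mono) (use Suc.IH YV Suc.prems in \<open>auto simp: C_def\<close>)
  also have "\<dots> \<le> p * r * (1 + p * r) ^ l" using cY by simp
  also have "1 + p * r * (1 + p * r) ^ l \<le> (1 + p * r) ^ Suc l" by simp
  finally show ?case by (simp add: C_def)
qed

text \<open>Single edges to lower neighbours are admissible paths that meet only in
  \<open>v\<close>. The order is thus a degeneracy order, and edges are counted at their upper
  ends.\<close>

lemma card_back_neighbours:
  assumes v: "v \<in> verts G"
  shows "card (back_neighbours rk G v) \<le> p"
proof -
  define P where "P = (\<lambda>u. [v, u]) ` back_neighbours rk G v"
  have "card P \<le> p"
  proof (rule packing_bound[OF v])
    fix xs assume "xs \<in> P"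
    then obtain u where u: "xs = [v, u]" "u \<in> back_neighbours rk G v" by (auto simp: P_def)
    hence "{v, u} \<in> edges G" "rk u < rk v" by (auto simp: back_neighbours_def neighbours_def)
    with simple_edge[OF simple this(1)] show "is_path G xs \<and> hd xs = v \<and> last xs \<noteq> v \<and>
            (\<forall>w\<in>set xs. rk (last xs) \<le> rk w) \<and> length xs \<le> Suc r"
      using u r_pos by (auto simp: is_path_conv)
  qed (auto simp: P_def back_neighbours_def)
  moreover have "card P = card (back_neighbours rk G v)"
    unfolding P_def by (rule card_image) (auto simp: inj_on_def)
  ultimately show ?thesis by simp
qed

text \<open>Each edge leads downwards from exactly one of its ends and is counted at both.\<close>

lemma sum_degree: "(\<Sum>v\<in>verts G. card (neighbours G v)) \<le> 2 * p * card (verts G)"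
proof -
  let ?V = "verts G"
  let ?f = "\<lambda>v u. if u \<in> back_neighbours rk G v then 1 else 0 :: nat"
  have eq: "(\<Sum>u\<in>?V. ?f v u) = card (back_neighbours rk G v)" for v
    using finite_verts
    by (auto simp: sum.If_cases back_neighbours_def neighbours_def intro!: arg_cong[where f=card])
  have "card (neighbours G v) \<le> (\<Sum>u\<in>?V. ?f v u + ?f u v)" if "v \<in> ?V" for v
  proof -
    have "card (neighbours G v) = (\<Sum>u\<in>?V. if u \<in> neighbours G v then 1 else 0)"
      using finite_verts
      by (auto simp: sum.If_cases neighbours_def intro!: arg_cong[where f=card])
    also have "\<dots> \<le> (\<Sum>u\<in>?V. ?f v u + ?f u v)"
    proof (rule sum_mono)
      fix u assume u: "u \<in> ?V"
      show "(if u \<in> neighbours G v then 1 else 0) \<le> ?f v u + ?f u v"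
      proof (cases "u \<in> neighbours G v")
        case True
        hence e: "{v, u} \<in> edges G" by (simp add: neighbours_def)
        hence "rk u \<noteq> rk v" using simple_edge[OF simple e] rk_inj by (auto simp: inj_on_def)
        thus ?thesis using e u that by (auto simp: back_neighbours_def neighbours_def insert_commute)
      qed simp
    qed
    finally show ?thesis .
  qed
  hence "(\<Sum>v\<in>?V. card (neighbours G v)) \<le> (\<Sum>v\<in>?V. \<Sum>u\<in>?V. ?f v u + ?f u v)"
    by (rule sum_mono)
  also have "\<dots> = (\<Sum>v\<in>?V. \<Sum>u\<in>?V. ?f v u) + (\<Sum>u\<in>?V. \<Sum>v\<in>?V. ?f u v)"
    unfolding sum.distrib by (subst (2) sum.swap) simp
  also have "\<dots> = 2 * (\<Sum>v\<in>?V. card (back_neighbours rk G v))" by (simp add: eq)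
  also have "\<dots> \<le> 2 * (\<Sum>v\<in>?V. p)"
    by (intro mult_left_mono sum_mono card_back_neighbours) auto
  finally show ?thesis by (simp add: algebra_simps)
qed

end

section \<open>Pruning\<close>

text \<open>Emptying the violated \<open>X i F\<close> one after the other costs at most \<open>b i\<close> for each \<open>i\<close>, since by
  monotonicity an emptied one stays empty.\<close>

lemma prune:
  fixes X :: "'i \<Rightarrow> 'e set \<Rightarrow> 'e set" and b :: "'i \<Rightarrow> real"
  assumes fin: "finite I" "finite E"
    and sub: "\<And>i F. i \<in> I \<Longrightarrow> X i F \<subseteq> F"
    and mono: "\<And>i F F'. i \<in> I \<Longrightarrow> F \<subseteq> F' \<Longrightarrow> X i F \<subseteq> X i F'"
    and b: "\<And>i. i \<in> I \<Longrightarrow> 0 \<le> b i"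
  shows "\<exists>E'\<subseteq>E. real (card (E - E')) \<le> sum b I \<and> (\<forall>i\<in>I. X i E' = {} \<or> b i \<le> real (card (X i E')))"
proof -
  define Q where "Q = (\<lambda>J. J \<subseteq> I \<and> (\<exists>E'\<subseteq>E. real (card (E - E')) \<le> sum b J \<and> (\<forall>i\<in>J. X i E' = {})))"
  have "Q {}" unfolding Q_def by (intro conjI exI[of _ E]) auto
  moreover have "card J < Suc (card I)" if "Q J" for J
    using that fin by (auto simp: Q_def less_Suc_eq_le card_mono)
  ultimately obtain J where J: "Q J" "\<And>J'. Q J' \<Longrightarrow> card J' \<le> card J"
    using ex_has_greatest_nat[of Q "{}" card "Suc (card I)"] by blast
  then obtain E' where E': "E' \<subseteq> E" "real (card (E - E')) \<le> sum b J" "\<forall>i\<in>J. X i E' = {}" and JI: "J \<subseteq> I"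
    unfolding Q_def by blast
  have finJ: "finite J" using JI fin finite_subset by blast
  have "X i E' = {} \<or> b i \<le> real (card (X i E'))" if i: "i \<in> I" for i
  proof (rule ccontr)
    assume neg: "\<not> ?thesis"
    hence iJ: "i \<notin> J" using E' by blast
    define E'' where "E'' = E' - X i E'"
    have "E - E'' = (E - E') \<union> X i E'" using E'(1) sub[OF i, of E'] by (auto simp: E''_def)
    hence "card (E - E'') \<le> card (E - E') + card (X i E')" by (simp add: card_Un_le)
    hence "real (card (E - E'')) \<le> real (card (E - E')) + real (card (X i E'))"
      by (metis of_nat_add of_nat_mono)
    also have "\<dots> \<le> sum b (insert i J)" using E'(2) neg iJ finJ by simp
    finally have "real (card (E - E'')) \<le> sum b (insert i J)" .
    moreover have "X j E'' = {}" if "j \<in> insert i J" for j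
    proof (cases "j = i")
      case True
      \<comment> \<open>Being a subset of \<open>E''\<close> as well, \<open>X i E''\<close> is
        disjoint from the set \<open>X i E'\<close> that contains it.\<close>
      have "X i E'' \<subseteq> X i E'" by (rule mono[OF i]) (auto simp: E''_def)
      with sub[OF i, of E''] True show ?thesis by (auto simp: E''_def)
    next
      case False
      hence "j \<in> J" using that by simp
      moreover have "X j E'' \<subseteq> X j E'" by (rule mono) (use JI \<open>j \<in> J\<close> in \<open>auto simp: E''_def\<close>)
      ultimately show ?thesis using E'(3) by blast
    qed
    ultimately have "Q (insert i J)"
      unfolding Q_def using JI i E'(1) by (intro conjI exI[of _ E'']) (auto simp: E''_def)
    from J(2)[OF this] iJ finJ show False by simp
  qed
  moreover have "sum b J \<le> sum b I" by (rule sum_mono2) (use fin JI b in auto)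
  ultimately show ?thesis using E' by (intro exI[of _ E']) auto
qed

text \<open>Copies of \<open>H\<close> are handled as maps into an edge set, which may be a pruned
  one. That the images are vertices of \<open>G\<close> then follows from \<open>H\<close> having no
  isolated vertex.\<close>

definition embedding :: "'b ugraph \<Rightarrow> 'a set set \<Rightarrow> ('b \<Rightarrow> 'a) \<Rightarrow> bool" where
  "embedding H F \<psi> \<longleftrightarrow> inj_on \<psi> (verts H) \<and> (\<forall>e\<in>edges H. \<psi> ` e \<in> F)"

definition boundary :: "'b ugraph \<Rightarrow> 'b set \<Rightarrow> 'b set" where
  "boundary H K = {a \<in> verts H - K. \<exists>k\<in>K. {a, k} \<in> edges H}"

definition inner_edges :: "'b ugraph \<Rightarrow> 'b set \<Rightarrow> ('b \<Rightarrow> 'a) \<Rightarrow> 'a set set" where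
  "inner_edges H K \<theta> = (\<lambda>e. \<theta> ` e) ` {e \<in> edges H. e \<subseteq> K}"

lemma list_crossing:
  assumes "successively P xs" "xs \<noteq> []" "hd xs \<in> K" "last xs \<notin> K"
  shows "\<exists>u v. u \<in> K \<and> v \<notin> K \<and> u \<in> set xs \<and> v \<in> set xs \<and> P u v"
  using assms
proof (induction xs)
  case (Cons x xs)
  show ?case
  proof (cases "xs = [] \<or> hd xs \<notin> K")
    case True
    hence "xs \<noteq> []" "hd xs \<notin> K" using Cons.prems by auto
    with Cons.prems show ?thesis
      by (intro exI[of _ x] exI[of _ "hd xs"]) (auto simp: successively_Cons)
  next
    case False
    with Cons show ?thesis by (auto simp: successively_Cons)
  qed
qed simp

section \<open>Pruning rules for the copies of \<open>H\<close>\<close>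

locale pattern_graph = ordered_graph G R rk p r
  for G :: "'a ugraph" and R rk p r +
  fixes H :: "'b ugraph" and \<epsilon> :: real
  assumes H: "simple_graph H" "connected_graph H" "card (verts H) \<le> r" "card (verts H) \<ge> 2"
    and p_pos: "p \<ge> 1" and eps_pos: "\<epsilon> > 0"
begin

abbreviation "V \<equiv> verts G"
abbreviation "E \<equiv> edges G"
abbreviation "deg v \<equiv> card (neighbours G v)"

text \<open>\<open>c\<close> bounds the number of vertices weakly reachable from a vertex and \<open>T\<close> the number of patterns at a
  vertex. The ratio \<open>D2\<close> makes the total loss caused by the patterns at most a quarter of the allowed
  \<open>\<epsilon> n\<close>. The ratio \<open>D\<close> is such that \<open>r * c\<close> vertices, each met by less than \<open>deg h / D\<close> of the
  extensions at \<open>h\<close>, spoil at most half of \<open>deg h / D2\<close> extensions.\<close>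

definition c :: nat where "c = (1 + p * r) ^ r"
definition T :: nat where "T = 2 ^ r * c ^ r * r"
definition D2 :: real where "D2 = 8 * p * T / \<epsilon>"
definition D :: real where "D = 2 * r * c * D2"

text \<open>This is the weak \<open>r\<close>-reachability set of \<open>h\<close>;
  \<open>reach\<close> itself is indexed by the target.\<close>

definition C :: "'a \<Rightarrow> 'a set" where "C h = {m. h \<in> reach rk E m r}"

text \<open>The heavy vertices of \<open>h\<close>, which a random neighbour of \<open>h\<close> reaches with probability at least
  \<open>1 / D\<close>. They refer to the unpruned graph: this keeps the pruning rules below monotone in the edge set.\<close>

definition Z :: "'a \<Rightarrow> 'a set" where
  "Z h = {m \<in> V. real (deg h) \<le> D * card {x \<in> neighbours G h. x \<in> reach rk E m r}}"

text \<open>The answers at \<open>h\<close> after which at most \<open>l\<close> more steps lead to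
  \<open>m\<close>. The ranks of \<open>h\<close> and \<open>m\<close> are not compared, as a heavy
  target may lie above \<open>h\<close>.\<close>

definition steps :: "'a set set \<Rightarrow> 'a \<Rightarrow> 'a \<Rightarrow> nat \<Rightarrow> 'a set" where
  "steps F h m l = {x. {h, x} \<in> F \<and> x \<in> reach rk F m l}"

text \<open>Vertices of \<open>S\<close> are forbidden only where \<open>\<theta> k0\<close> weakly
  reaches them inside the placed part; this is what can be verified for a given copy, and it is
  enough against collisions. Reachability is taken in \<open>inner_edges\<close> and not in
  \<open>F\<close>: the condition is negative, and with \<open>F\<close> in it monotonicity would be
  lost.\<close>

definition attaches ::
  "'a set set \<Rightarrow> 'a set \<Rightarrow> 'b set \<Rightarrow> ('b \<Rightarrow> 'a) \<Rightarrow> 'b \<Rightarrow> ('b \<Rightarrow> 'a) \<Rightarrow> bool" where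
  "attaches F S K \<phi> k0 \<theta> \<longleftrightarrow> inj_on \<theta> K \<and> \<theta> ` K \<subseteq> V \<and>
     (\<forall>e\<in>edges H. e \<inter> K \<noteq> {} \<longrightarrow> (\<lambda>u. if u \<in> K then \<theta> u else \<phi> u) ` e \<in> F) \<and>
     (\<forall>k\<in>K. \<theta> k0 \<in> reach rk (inner_edges H K \<theta>) (\<theta> k) (r - 1) \<longrightarrow> \<theta> k \<notin> S)"

text \<open>The candidates for the image of \<open>k0\<close> when the part \<open>K\<close> of a copy is placed anew, with its boundary
  fixed by \<open>\<phi>\<close> and the edge to \<open>h\<close> entering \<open>K\<close> at \<open>k0\<close>.\<close>

definition extensions ::
  "'a set set \<Rightarrow> 'a \<Rightarrow> 'b set \<Rightarrow> ('b \<Rightarrow> 'a) \<Rightarrow> 'b \<Rightarrow> 'a set" where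
  "extensions F h K \<phi> k0 = {x. {h, x} \<in> F \<and> (\<exists>\<theta>. \<theta> k0 = x \<and> attaches F (Z h) K \<phi> k0 \<theta>)}"

lemma finite_E: "finite E"
proof (rule finite_subset)
  show "E \<subseteq> Pow V" using simple by (auto simp: simple_graph_def)
qed (use finite_verts in simp)

lemma finite_H: "finite (verts H)" using H(1) by (simp add: simple_graph_def)

lemma finite_neighbours: "finite (neighbours G v)"
  using finite_verts by (simp add: neighbours_def)

lemma edge_at_vertex:
  assumes "u \<in> verts H" shows "\<exists>v. {u, v} \<in> edges H"
proof -
  have "\<exists>w\<in>verts H. w \<noteq> u"
  proof (rule ccontr)
    assume "\<not> ?thesis"
    hence "verts H \<subseteq> {u}" by blast
    from card_mono[OF _ this] H(4) show False by simp
  qed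
  then obtain w where "w \<in> verts H" "w \<noteq> u" by blast
  then obtain xs where xs: "is_path H xs" "hd xs = u" "last xs = w"
    using H(2) assms by (auto simp: connected_graph_def)
  with list_crossing[of "\<lambda>u v. {u, v} \<in> edges H" xs "{u}"] \<open>w \<noteq> u\<close>
  show ?thesis by (auto simp: is_path_conv)
qed

lemma c_ge_1: "c \<ge> 1" by (simp add: c_def)

lemma T_ge_1: "T \<ge> 1" using c_ge_1 r_pos by (simp add: T_def Suc_leI)

lemma D2_pos: "D2 > 0" using eps_pos p_pos T_ge_1 by (simp add: D2_def)

lemma D_pos: "D > 0" using D2_pos c_ge_1 r_pos by (simp add: D_def)

lemma C_subset: "v \<in> V \<Longrightarrow> C v \<subseteq> V"
  using reach_in_verts[OF simple] by (auto simp: C_def)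

lemma finite_C: "v \<in> V \<Longrightarrow> finite (C v)"
  using C_subset finite_verts finite_subset by blast

lemma card_C: "v \<in> V \<Longrightarrow> card (C v) \<le> c"
  using card_reached[of r v] by (simp add: C_def c_def)

lemma finite_Z: "finite (Z h)"
  using finite_verts by (simp add: Z_def)

lemma neighbours_subset: "neighbours G h \<subseteq> V"
  by (auto simp: neighbours_def)

text \<open>Double counting of the pairs of a heavy vertex \<open>m\<close> and a neighbour
  \<open>x\<close> of \<open>h\<close> that weakly reaches it: at least \<open>deg h / D\<close> for
  each \<open>m\<close>, at most \<open>c\<close> for each \<open>x\<close>.\<close>

lemma card_Z:
  assumes d: "deg h > 0"
  shows "card (Z h) \<le> c * D"
proof -
  let ?f = "\<lambda>m x. if x \<in> reach rk E m r then 1 else 0 :: nat"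
  have "(\<Sum>m\<in>Z h. real (deg h)) \<le> (\<Sum>m\<in>Z h. D * card {x \<in> neighbours G h. x \<in> reach rk E m r})"
    by (rule sum_mono) (simp add: Z_def)
  also have "\<dots> = D * (\<Sum>m\<in>Z h. card {x \<in> neighbours G h. x \<in> reach rk E m r})"
    by (simp add: sum_distrib_left)
  also have "(\<Sum>m\<in>Z h. card {x \<in> neighbours G h. x \<in> reach rk E m r}) =
      (\<Sum>m\<in>Z h. \<Sum>x\<in>neighbours G h. ?f m x)"
    using finite_neighbours by (simp add: sum.If_cases Int_def)
  also have "\<dots> = (\<Sum>x\<in>neighbours G h. \<Sum>m\<in>Z h. ?f m x)" by (rule sum.swap)
  also have "\<dots> \<le> (\<Sum>x\<in>neighbours G h. c)"
  proof (rule sum_mono)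
    fix x assume x: "x \<in> neighbours G h"
    hence xV: "x \<in> V" using neighbours_subset by blast
    have "(\<Sum>m\<in>Z h. ?f m x) = card (Z h \<inter> C x)"
      using finite_Z by (simp add: sum.If_cases C_def)
    also have "\<dots> \<le> card (C x)" by (rule card_mono) (use finite_C[OF xV] in auto)
    finally show "(\<Sum>m\<in>Z h. ?f m x) \<le> c" using card_C[OF xV] by simp
  qed
  finally have "real (deg h) * card (Z h) \<le> D * (c * deg h)"
    using D_pos by (simp add: mult.commute mult_left_mono)
  thus ?thesis using d by (simp add: mult_ac)
qed

lemma steps_subset: "F \<subseteq> E \<Longrightarrow> steps F h m l \<subseteq> neighbours G h"
  using simple_edge[OF simple] by (auto simp: steps_def neighbours_def)

lemma extensions_subset: "F \<subseteq> E \<Longrightarrow> extensions F h K \<phi> k0 \<subseteq> neighbours G h"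
  using simple_edge[OF simple] by (auto simp: extensions_def neighbours_def)

lemma steps_mono: "F \<subseteq> F' \<Longrightarrow> steps F h m l \<subseteq> steps F' h m l"
  using reach_mono[of l l F F'] by (auto simp: steps_def)

lemma extensions_mono: "F \<subseteq> F' \<Longrightarrow> extensions F h K \<phi> k0 \<subseteq> extensions F' h K \<phi> k0"
proof -
  assume F: "F \<subseteq> F'"
  have "attaches F' (Z h) K \<phi> k0 \<theta>" if "attaches F (Z h) K \<phi> k0 \<theta>" for \<theta>
    using that subsetD[OF F] unfolding attaches_def by simp
  thus ?thesis using F unfolding extensions_def by blast
qed

lemma card_star: "finite S \<Longrightarrow> card ((\<lambda>x. {h, x}) ` S) = card S"
  by (rule card_image) (auto simp: inj_on_def doubleton_eq_iff)

text \<open>Confining the boundary images to \<open>C h\<close> makes the count independent of the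
  size of \<open>G\<close>: at most \<open>2 ^ r\<close> choices of \<open>K\<close>,
  \<open>c ^ r\<close> of the boundary map and \<open>r\<close> of the entry vertex. The maps are
  extensional, so that there are finitely many.\<close>

definition patterns :: "'a \<Rightarrow> ('b set \<times> ('b \<Rightarrow> 'a) \<times> 'b) set" where
  "patterns h = Sigma (Pow (verts H)) (\<lambda>K. PiE (boundary H K) (\<lambda>_. C h) \<times> K)"

lemma boundary_subset: "boundary H K \<subseteq> verts H"
  by (auto simp: boundary_def)

lemma finite_pattern_choices:
  assumes "h \<in> V" "K \<subseteq> verts H"
  shows "finite (PiE (boundary H K) (\<lambda>_. C h) \<times> K)"
  using finite_subset[OF boundary_subset finite_H, of K] finite_subset[OF assms(2) finite_H] finite_C[OF assms(1)]
  by (intro finite_cartesian_product finite_PiE) auto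

lemma finite_patterns: "h \<in> V \<Longrightarrow> finite (patterns h)"
  unfolding patterns_def using finite_H
  by (intro finite_SigmaI finite_pattern_choices) auto

lemma card_patterns: assumes h: "h \<in> V" shows "card (patterns h) \<le> T"
proof -
  have "card (patterns h) = (\<Sum>K\<in>Pow (verts H). card (PiE (boundary H K) (\<lambda>_. C h) \<times> K))"
    unfolding patterns_def using finite_H finite_pattern_choices[OF h]
    by (intro card_SigmaI) auto
  also have "\<dots> \<le> (\<Sum>K\<in>Pow (verts H). c ^ r * r)"
  proof (rule sum_mono)
    fix K assume K: "K \<in> Pow (verts H)"
    have cb: "card (boundary H K) \<le> r"
      using card_mono[OF finite_H boundary_subset[of K]] H(3) by simp
    have "card (PiE (boundary H K) (\<lambda>_. C h)) = card (C h) ^ card (boundary H K)"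
      using finite_subset[OF boundary_subset finite_H] by (subst card_PiE) auto
    also have "\<dots> \<le> c ^ card (boundary H K)" by (rule power_mono) (use card_C[OF h] in auto)
    also have "\<dots> \<le> c ^ r" by (rule power_increasing) (use cb c_ge_1 in auto)
    finally show "card (PiE (boundary H K) (\<lambda>_. C h) \<times> K) \<le> c ^ r * r"
      using card_mono[OF finite_H, of K] K H(3) by (auto simp: card_cartesian_product intro!: mult_mono)
  qed
  also have "\<dots> = 2 ^ card (verts H) * (c ^ r * r)" by (simp add: card_Pow finite_H)
  also have "\<dots> \<le> 2 ^ r * (c ^ r * r)" by (intro mult_right_mono power_increasing) (use H in auto)
  finally show ?thesis by (simp add: T_def)
qed

text \<open>At \<open>h\<close> there are at most \<open>c * D + c\<close> targets and
  \<open>r\<close> lengths, each costing at most \<open>deg h / \<delta>\<close>. With the degree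
  sum \<open>2 * p * card V\<close> the hypothesis on \<open>\<delta>\<close> turns this into a
  quarter of \<open>\<epsilon> * card V\<close>; the patterns cost another quarter.\<close>

lemma pruned_edges:
  fixes \<delta> :: real
  assumes delta: "8 * p * r * c * (D + 1) / \<epsilon> \<le> \<delta>"
  shows "\<exists>E'\<subseteq>E. real (card (E - E')) \<le> \<epsilon> / 2 * card V \<and>
    (\<forall>h\<in>V. \<forall>m\<in>Z h \<union> C h. \<forall>l<r. steps E' h m l \<noteq> {} \<longrightarrow> deg h \<le> \<delta> * card (steps E' h m l)) \<and>
    (\<forall>h\<in>V. \<forall>(K, \<phi>, k0)\<in>patterns h. extensions E' h K \<phi> k0 \<noteq> {} \<longrightarrow>
        deg h \<le> D2 * card (extensions E' h K \<phi> k0))"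
proof -
  have dpos: "\<delta> > 0"
    by (rule less_le_trans[OF _ delta]) (use p_pos r_pos c_ge_1 D_pos eps_pos in auto)
  \<comment> \<open>At an isolated vertex every vertex would count as heavy, so the bound on
    \<open>Z h\<close> is available only for positive degree.\<close>
  define V' where "V' = {h \<in> V. deg h > 0}"
  define I1 where "I1 = Sigma V' (\<lambda>h. (Z h \<union> C h) \<times> {..<r})"
  define I2 where "I2 = Sigma V' patterns"
  define X where "X = (\<lambda>i F. if F \<subseteq> E then case i of
       Inl (h, m, l) \<Rightarrow> (\<lambda>x. {h, x}) ` steps F h m l
     | Inr (h, K, \<phi>, k0) \<Rightarrow> (\<lambda>x. {h, x}) ` extensions F h K \<phi> k0 else (F :: 'a set set))"
  define b where "b = (\<lambda>i. case i of Inl (h, m :: 'a, l :: nat) \<Rightarrow> deg h / \<delta>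
     | Inr (h, K :: 'b set, \<phi> :: 'b \<Rightarrow> 'a, k0 :: 'b) \<Rightarrow> deg h / D2)"
  have V': "finite V'" "V' \<subseteq> V" using finite_verts by (auto simp: V'_def)
  have fin: "finite I1" "finite I2"
    unfolding I1_def I2_def using V' finite_Z finite_C finite_patterns
    by (intro finite_SigmaI finite_cartesian_product; auto)+
  have ex: "\<exists>E'\<subseteq>E. real (card (E - E')) \<le> sum b (I1 <+> I2) \<and>
      (\<forall>i\<in>I1 <+> I2. X i E' = {} \<or> b i \<le> real (card (X i E')))"
  proof (rule prune)
    show "finite (I1 <+> I2)" using fin by simp
    show "finite E" by (rule finite_E)
    show "X i F \<subseteq> F" if "i \<in> I1 <+> I2" for i F
      using that by (auto simp: X_def steps_def extensions_def split: sum.splits)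
    show "X i F \<subseteq> X i F'" if "i \<in> I1 <+> I2" "F \<subseteq> F'" for i F F'
    proof (cases "F' \<subseteq> E")
      case True
      thus ?thesis using that(2) steps_mono[OF that(2)] extensions_mono[OF that(2)]
        by (auto simp: X_def split: sum.splits) blast+
    next
      case False
      have "X i F \<subseteq> F" by (auto simp: X_def steps_def extensions_def split: sum.splits)
      thus ?thesis using False that(2) by (auto simp: X_def)
    qed
    show "0 \<le> b i" if "i \<in> I1 <+> I2" for i
      using dpos D2_pos by (auto simp: b_def split: sum.splits)
  qed
  then obtain E' where E': "E' \<subseteq> E" "real (card (E - E')) \<le> sum b (I1 <+> I2)"
      "\<And>i. i \<in> I1 <+> I2 \<Longrightarrow> X i E' = {} \<or> b i \<le> real (card (X i E'))"
    by blast
  have sumdeg: "(\<Sum>h\<in>V'. real (deg h)) \<le> 2 * p * card V"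
  proof -
    have "(\<Sum>h\<in>V'. deg h) \<le> (\<Sum>h\<in>V. deg h)" by (rule sum_mono2) (use V' finite_verts in auto)
    also have "\<dots> \<le> 2 * p * card V" by (rule sum_degree)
    finally show ?thesis by (metis of_nat_mono of_nat_sum)
  qed
  have "sum b (I1 <+> I2) = (\<Sum>i\<in>I1. b (Inl i)) + (\<Sum>i\<in>I2. b (Inr i))"
    using fin by (subst sum.Plus) auto
  also have "(\<Sum>i\<in>I1. b (Inl i)) = (\<Sum>h\<in>V'. \<Sum>i\<in>(Z h \<union> C h) \<times> {..<r}. deg h / \<delta>)"
    unfolding I1_def b_def using V' finite_Z finite_C
    by (subst sum.Sigma) (auto intro!: sum.cong)
  also have "\<dots> \<le> (\<Sum>h\<in>V'. (c * (D + 1) * r / \<delta>) * deg h)"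
  proof (rule sum_mono)
    fix h assume h: "h \<in> V'"
    have "card (Z h \<union> C h) \<le> card (Z h) + card (C h)" by (rule card_Un_le)
    hence "real (card (Z h \<union> C h)) \<le> real (card (Z h)) + real (card (C h))" by linarith
    also have "\<dots> \<le> c * D + c"
      using card_Z[of h] card_C[of h] h V' by (intro add_mono) (auto simp: V'_def)
    finally have "real (card (Z h \<union> C h)) * (r * (deg h / \<delta>)) \<le> (c * (D + 1)) * (r * (deg h / \<delta>))"
      using dpos by (intro mult_right_mono) (auto simp: algebra_simps)
    thus "(\<Sum>i\<in>(Z h \<union> C h) \<times> {..<r}. deg h / \<delta>) \<le> (c * (D + 1) * r / \<delta>) * deg h"
      by (simp add: card_cartesian_product mult_ac)
  qed
  also have "\<dots> = (c * (D + 1) * r / \<delta>) * (\<Sum>h\<in>V'. deg h)"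
    by (simp add: sum_distrib_left)
  also have "\<dots> \<le> (c * (D + 1) * r / \<delta>) * (2 * p * card V)"
    by (rule mult_left_mono) (use sumdeg dpos D_pos in auto)
  also have "\<dots> \<le> \<epsilon> / 4 * card V"
  proof -
    have "8 * p * r * c * (D + 1) \<le> \<delta> * \<epsilon>" using delta eps_pos by (simp add: field_simps)
    hence "(c * (D + 1) * r / \<delta>) * (2 * p) \<le> \<epsilon> / 4"
      using dpos by (simp add: field_simps)
    from mult_right_mono[OF this, of "real (card V)"] show ?thesis by (simp only: mult.assoc of_nat_mult of_nat_numeral)
  qed
  also have "(\<Sum>i\<in>I2. b (Inr i)) = (\<Sum>h\<in>V'. \<Sum>i\<in>patterns h. deg h / D2)"
    unfolding I2_def b_def using V' finite_patterns
    by (subst sum.Sigma) (auto intro!: sum.cong)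
  also have "\<dots> \<le> (\<Sum>h\<in>V'. (T / D2) * deg h)"
  proof (rule sum_mono)
    fix h assume h: "h \<in> V'"
    have "real (card (patterns h)) * (deg h / D2) \<le> T * (deg h / D2)"
      using card_patterns[of h] h V' D2_pos by (intro mult_right_mono) auto
    thus "(\<Sum>i\<in>patterns h. deg h / D2) \<le> (T / D2) * deg h" by simp
  qed
  also have "\<dots> = (T / D2) * (\<Sum>h\<in>V'. deg h)"
    by (simp add: sum_distrib_left)
  also have "\<dots> \<le> (T / D2) * (2 * p * card V)"
    by (rule mult_left_mono) (use sumdeg D2_pos in auto)
  also have "\<dots> = \<epsilon> / 4 * card V"
    using eps_pos p_pos T_ge_1 by (simp add: D2_def field_simps)
  finally have total: "sum b (I1 <+> I2) \<le> \<epsilon> / 2 * card V" by simp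
  have st: "deg h \<le> \<delta> * card (steps E' h m l)"
    if h: "h \<in> V" "m \<in> Z h \<union> C h" "l < r" "steps E' h m l \<noteq> {}" for h m l
  proof -
    have "deg h > 0"
      using steps_subset[OF E'(1), of h m l] h(4) finite_neighbours[of h] by (auto simp: card_gt_0_iff)
    hence "Inl (h, m, l) \<in> I1 <+> I2" using h by (auto simp: I1_def V'_def)
    from E'(3)[OF this] have "deg h / \<delta> \<le> card ((\<lambda>x. {h, x}) ` steps E' h m l)"
      using h(4) E'(1) by (auto simp: X_def b_def)
    also have "card ((\<lambda>x. {h, x}) ` steps E' h m l) = card (steps E' h m l)"
      by (rule card_star) (rule finite_subset[OF steps_subset[OF E'(1)] finite_neighbours])
    finally show ?thesis using dpos by (simp add: field_simps)
  qed
  have exn: "deg h \<le> D2 * card (extensions E' h K \<phi> k0)"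
    if h: "h \<in> V" "(K, \<phi>, k0) \<in> patterns h" "extensions E' h K \<phi> k0 \<noteq> {}" for h K \<phi> k0
  proof -
    have "deg h > 0"
      using extensions_subset[OF E'(1), of h K \<phi> k0] h(3) finite_neighbours[of h]
      by (auto simp: card_gt_0_iff)
    hence "Inr (h, K, \<phi>, k0) \<in> I1 <+> I2" using h by (auto simp: I2_def V'_def)
    from E'(3)[OF this] have "deg h / D2 \<le> card ((\<lambda>x. {h, x}) ` extensions E' h K \<phi> k0)"
      using h(3) E'(1) by (auto simp: X_def b_def)
    also have "card ((\<lambda>x. {h, x}) ` extensions E' h K \<phi> k0) = card (extensions E' h K \<phi> k0)"
      by (rule card_star) (rule finite_subset[OF extensions_subset[OF E'(1)] finite_neighbours])
    finally show ?thesis using D2_pos by (simp add: field_simps)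
  qed
  have "\<forall>h\<in>V. \<forall>(K, \<phi>, k0)\<in>patterns h. extensions E' h K \<phi> k0 \<noteq> {} \<longrightarrow>
        deg h \<le> D2 * card (extensions E' h K \<phi> k0)"
    using exn by blast
  moreover have "real (card (E - E')) \<le> \<epsilon> / 2 * card V" using E'(2) total by linarith
  moreover have "\<forall>h\<in>V. \<forall>m\<in>Z h \<union> C h. \<forall>l<r. steps E' h m l \<noteq> {} \<longrightarrow>
      deg h \<le> \<delta> * card (steps E' h m l)"
    using st by blast
  ultimately show ?thesis using E'(1) by (intro exI[of _ E'] conjI)
qed

end

section \<open>Extending partial copies\<close>

locale pruned_graph = pattern_graph G R rk p r H \<epsilon>
  for G :: "'a ugraph" and R rk p r and H :: "'b ugraph" and \<epsilon> +
  fixes \<delta> :: real and E' :: "'a set set"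
  assumes E'_sub: "E' \<subseteq> E"
    and steps_many: "\<And>h m l. h \<in> V \<Longrightarrow> m \<in> Z h \<union> C h \<Longrightarrow> l < r \<Longrightarrow> steps E' h m l \<noteq> {} \<Longrightarrow>
          deg h \<le> \<delta> * card (steps E' h m l)"
    and extensions_many: "\<And>h K \<phi> k0. h \<in> V \<Longrightarrow> (K, \<phi>, k0) \<in> patterns h \<Longrightarrow>
          extensions E' h K \<phi> k0 \<noteq> {} \<Longrightarrow> deg h \<le> D2 * card (extensions E' h K \<phi> k0)"
    and delta_ge: "2 * D2 \<le> \<delta>"
begin

lemma embedding_inj: "embedding H E' \<psi> \<Longrightarrow> u \<in> verts H \<Longrightarrow> v \<in> verts H \<Longrightarrow> \<psi> u = \<psi> v \<Longrightarrow> u = v"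
  by (auto simp: embedding_def inj_on_def)

lemma embedding_edge: "embedding H E' \<psi> \<Longrightarrow> {u, v} \<in> edges H \<Longrightarrow> {\<psi> u, \<psi> v} \<in> E'"
  by (force simp: embedding_def)

lemma embedding_verts: assumes "embedding H E' \<psi>" "u \<in> verts H" shows "\<psi> u \<in> V"
  using edge_at_vertex[OF assms(2)] embedding_edge[OF assms(1)] E'_sub simple_edge(1)[OF simple] by blast

text \<open>Here \<open>A\<close> is the discovered part of a copy and no vertex of the rest can be discovered by weak
  reachability. Then a component \<open>K\<close> of the rest lies above its boundary, so all of the boundary is
  weakly reachable from its highest vertex \<open>h\<close>, and \<open>K\<close> contains no heavy vertex of \<open>h\<close> that its
  entry vertex weakly reaches inside \<open>K\<close>. The pruning rule provides many replacements of \<open>K\<close> at \<open>h\<close>.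
  A replacement can meet the fixed part of the copy in \<open>w\<close> only by passing a vertex that is not heavy and
  is weakly reachable from \<open>w\<close>, so few replacements do.\<close>

lemma many_extensions:
  assumes emb: "embedding H E' \<psi>" and A: "A \<subseteq> verts H" "A \<noteq> {}" "A \<noteq> verts H"
    and closed: "\<And>a b. a \<in> A \<Longrightarrow> b \<in> verts H - A \<Longrightarrow> \<psi> b \<in> Z (\<psi> a) \<union> C (\<psi> a) \<Longrightarrow>
      steps E' (\<psi> a) (\<psi> b) (r - 1) = {}"
  shows "\<exists>a\<in>A. \<exists>b\<in>verts H - A. \<exists>X\<subseteq>neighbours G (\<psi> a). X \<noteq> {} \<and> deg (\<psi> a) \<le> \<delta> * card X \<and>
    (\<forall>x\<in>X. \<exists>\<psi>'. embedding H E' \<psi>' \<and> (\<forall>u\<in>A. \<psi>' u = \<psi> u) \<and> \<psi>' b = x)"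
proof -
  obtain b0 where b0: "b0 \<in> verts H - A" using A by blast
  define rel where "rel = {(u, v). u \<in> verts H - A \<and> v \<in> verts H - A \<and> {u, v} \<in> edges H}"
  define K where "K = {k. (k, b0) \<in> rel\<^sup>*}"
  define N where "N = boundary H K"
  define \<phi> where "\<phi> = restrict \<psi> N"
  have symrel: "sym (rel\<^sup>*)"
    by (rule sym_rtrancl) (auto simp: rel_def sym_def insert_commute)
  have b0K: "b0 \<in> K" by (simp add: K_def)
  have KV: "K \<subseteq> verts H - A"
  proof
    fix k assume "k \<in> K"
    hence "(k, b0) \<in> rel\<^sup>*" by (simp add: K_def)
    thus "k \<in> verts H - A" using b0 by (cases rule: converse_rtranclE) (auto simp: rel_def)
  qed
  have Kclosed: "v \<in> K" if "k \<in> K" "{k, v} \<in> edges H" "v \<notin> A" for k v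
  proof -
    have "(v, k) \<in> rel" using that KV simple_edge[OF H(1) that(2)] by (auto simp: rel_def insert_commute)
    thus ?thesis using that(1) by (auto simp: K_def intro: converse_rtrancl_into_rtrancl)
  qed
  have NA: "N \<subseteq> A"
  proof
    fix a assume "a \<in> N"
    then obtain k where "k \<in> K" "{k, a} \<in> edges H" "a \<notin> K"
      by (auto simp: N_def boundary_def insert_commute)
    thus "a \<in> A" using Kclosed by blast
  qed
  have finK: "finite K" using KV finite_H finite_subset by blast
  \<comment> \<open>\<open>A\<close> takes at least one vertex of \<open>H\<close>, so a path inside
    \<open>K\<close> has at most \<open>r - 2\<close> edges, and at most \<open>r\<close> after
    adding an edge to the boundary at both ends.\<close>
  have cardK: "card K + 1 \<le> r"
  proof -
    obtain a where "a \<in> A" using A by blast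
    hence "insert a K \<subseteq> verts H" "a \<notin> K" using KV A by auto
    with card_mono[OF finite_H, of "insert a K"] finK H(3) show ?thesis by simp
  qed
  define HK where "HK = UGraph K {e \<in> edges H. e \<subseteq> K}"
  have pathK: "\<exists>xs. is_path HK xs \<and> hd xs = k \<and> last xs = k'" if "k \<in> K" "k' \<in> K" for k k'
  proof -
    have "(k, b0) \<in> rel\<^sup>*" "(b0, k') \<in> rel\<^sup>*" using that symD[OF symrel] by (auto simp: K_def)
    hence "(k, k') \<in> rel\<^sup>*" by (rule rtrancl_trans)
    thus ?thesis
    proof (induction rule: converse_rtrancl_induct)
      case base
      show ?case using that(2) by (intro exI[of _ "[k']"]) (auto simp: is_path_def HK_def)
    next
      case (step y z)
      have "(b0, k') \<in> rel\<^sup>*" using that symD[OF symrel] by (auto simp: K_def)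
      hence kb: "(k', b0) \<in> rel\<^sup>*" using symD[OF symrel] by blast
      have "z \<in> K" using rtrancl_trans[OF step(2) kb] by (simp add: K_def)
      moreover have "y \<in> K" using converse_rtrancl_into_rtrancl[OF step(1) rtrancl_trans[OF step(2) kb]] by (simp add: K_def)
      moreover have "{y, z} \<in> edges H" using step(1) by (simp add: rel_def)
      moreover from step obtain xs where xs: "is_path HK xs" "hd xs = z" "last xs = k'" by blast
      ultimately have "y \<in> verts HK" "{y, hd xs} \<in> edges HK" by (auto simp: HK_def)
      from path_extend[OF xs(1) this] xs(3) show ?case by blast
    qed
  qed
  have path_len: "length xs \<le> card K" "set xs \<subseteq> K" "xs \<noteq> []" if "is_path HK xs" for xs
    using that card_mono[OF finK, of "set xs"] distinct_card[of xs] by (auto simp: is_path_def HK_def)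
  have path_walk: "successively (\<lambda>u v. {u, v} \<in> inner_edges H K \<theta>) (map \<theta> xs)"
    if "is_path HK xs" for xs and \<theta> :: "'b \<Rightarrow> 'a"
    unfolding successively_map using that
    by (auto simp: is_path_conv HK_def inner_edges_def elim!: successively_mono intro: rev_image_eqI)
  \<comment> \<open>This is proved for every placement \<open>\<theta>\<close> of \<open>K\<close>,
    since it serves both the given copy and the replacements. Only images of edges inside
    \<open>K\<close> are walked, in accordance with the last condition of
    \<open>attaches\<close>.\<close>
  have meet: "\<exists>b\<in>K. \<theta> k1 \<in> reach rk (inner_edges H K \<theta>) (\<theta> b) (r - 1) \<and>
      \<theta> k2 \<in> reach rk (inner_edges H K \<theta>) (\<theta> b) (r - 1)"
    if \<theta>: "\<theta> ` K \<subseteq> V" and k: "k1 \<in> K" "k2 \<in> K" for \<theta> :: "'b \<Rightarrow> 'a" and k1 k2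
  proof -
    obtain xs where xs: "is_path HK xs" "hd xs = k1" "last xs = k2" using pathK k by blast
    note len = path_len[OF xs(1)]
    have "inj_on rk (set (map \<theta> xs))"
      by (rule inj_on_subset[OF rk_inj]) (use len \<theta> in auto)
    from walk_meet[OF path_walk[OF xs(1)] _ this] len obtain m where
      m: "m \<in> set (map \<theta> xs)" "hd (map \<theta> xs) \<in> reach rk (inner_edges H K \<theta>) m (length (map \<theta> xs) - 1)"
        "last (map \<theta> xs) \<in> reach rk (inner_edges H K \<theta>) m (length (map \<theta> xs) - 1)" by auto
    have l: "length (map \<theta> xs) - 1 \<le> r - 1" using len cardK by simp
    from m(1) len obtain b where "b \<in> K" "m = \<theta> b" by auto
    moreover have "hd (map \<theta> xs) = \<theta> k1" "last (map \<theta> xs) = \<theta> k2"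
      using xs len by (auto simp: hd_map last_map)
    ultimately show ?thesis using reachD_mono[OF m(2) l order_refl] reachD_mono[OF m(3) l order_refl] by auto
  qed
  have psiV: "\<psi> ` K \<subseteq> V" using KV embedding_verts[OF emb] by blast
  have inner_sub: "inner_edges H K \<psi> \<subseteq> E'" using emb by (auto simp: inner_edges_def embedding_def)
  \<comment> \<open>Let \<open>k1\<close> be a neighbour of \<open>a\<close> in \<open>K\<close>,
    and let \<open>k1\<close> and \<open>k\<close> meet in \<open>b\<close>. If \<open>b\<close>
    were placed below \<open>a\<close>, then \<open>a\<close> would weakly reach it and the edge
    into \<open>K\<close> would be a first step towards it, against \<open>closed\<close>. So
    \<open>a\<close> is below \<open>b\<close>, which is not above \<open>k\<close>.\<close>
  have above: "rk (\<psi> a) < rk (\<psi> k)" if ak: "a \<in> N" "k \<in> K" for a k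
  proof -
    obtain k1 where k1: "k1 \<in> K" "{a, k1} \<in> edges H" using ak by (auto simp: N_def boundary_def)
    obtain b where b: "b \<in> K" "\<psi> k1 \<in> reach rk (inner_edges H K \<psi>) (\<psi> b) (r - 1)"
      "\<psi> k \<in> reach rk (inner_edges H K \<psi>) (\<psi> b) (r - 1)" using meet[OF psiV k1(1) ak(2)] by blast
    have e: "{\<psi> a, \<psi> k1} \<in> E'" using embedding_edge[OF emb k1(2)] .
    have r1: "\<psi> k1 \<in> reach rk E' (\<psi> b) (r - 1)" using reachD_mono[OF b(2) order_refl inner_sub] .
    have aA: "a \<in> A" "a \<in> verts H" using NA ak A by auto
    have "\<not> rk (\<psi> b) < rk (\<psi> a)"
    proof
      assume "rk (\<psi> b) < rk (\<psi> a)"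
      hence "\<psi> a \<in> reach rk E' (\<psi> b) (Suc (r - 1))" using e r1 by auto
      hence "\<psi> a \<in> reach rk E (\<psi> b) r" using reachD_mono[OF _ _ E'_sub, of _ rk _ "Suc (r - 1)" r] r_pos by simp
      hence "\<psi> b \<in> C (\<psi> a)" by (simp add: C_def)
      moreover have "\<psi> k1 \<in> steps E' (\<psi> a) (\<psi> b) (r - 1)" using e r1 by (simp add: steps_def)
      ultimately show False using closed[OF aA(1), of b] b(1) KV by blast
    qed
    moreover have "rk (\<psi> b) \<le> rk (\<psi> k)" using reach_rank[OF b(3)] by auto
    moreover have "rk (\<psi> a) \<noteq> rk (\<psi> k)"
    proof
      assume "rk (\<psi> a) = rk (\<psi> k)"
      hence "\<psi> a = \<psi> k" using inj_onD[OF rk_inj] embedding_verts[OF emb] aA ak KV by blast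
      hence "a = k" using embedding_inj[OF emb] aA ak KV by blast
      thus False using aA ak KV by blast
    qed
    ultimately show ?thesis by linarith
  qed
  have "N \<noteq> {}"
  proof -
    obtain a where a: "a \<in> A" using A by blast
    then obtain xs where xs: "is_path H xs" "hd xs = b0" "last xs = a"
      using H(2) A b0 unfolding connected_graph_def by blast
    have "\<exists>u v. u \<in> K \<and> v \<notin> K \<and> u \<in> set xs \<and> v \<in> set xs \<and> {u, v} \<in> edges H"
      by (rule list_crossing) (use xs b0K a KV in \<open>auto simp: is_path_conv\<close>)
    then obtain u v where "u \<in> K" "v \<notin> K" "{u, v} \<in> edges H" by blast
    hence "v \<in> N" using simple_edge(2)[OF H(1)] by (auto simp: N_def boundary_def insert_commute)
    thus ?thesis by blast
  qed
  moreover have finN: "finite N" using NA A finite_H finite_subset by metis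
  ultimately have "\<exists>a0\<in>N. \<forall>a\<in>N. rk (\<psi> a) \<le> rk (\<psi> a0)"
    using Max_in[of "(\<lambda>a. rk (\<psi> a)) ` N"] Max_ge[of "(\<lambda>a. rk (\<psi> a)) ` N"] by fastforce
  then obtain a0 where a0: "a0 \<in> N" "\<And>a. a \<in> N \<Longrightarrow> rk (\<psi> a) \<le> rk (\<psi> a0)"
    by blast
  define h where "h = \<psi> a0"
  obtain k0 where k0: "k0 \<in> K" "{a0, k0} \<in> edges H" using a0(1) by (auto simp: N_def boundary_def)
  have a0A: "a0 \<in> A" "a0 \<in> verts H" using a0 NA A by auto
  have hV: "h \<in> V" using embedding_verts[OF emb a0A(2)] by (simp add: h_def)
  \<comment> \<open>On a walk from \<open>h\<close> through \<open>K\<close> to \<open>a\<close> the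
    lowest vertex is \<open>a\<close>: \<open>K\<close> is above the boundary, and \<open>h\<close>
    is the highest vertex of the boundary. Hence the boundary map is among those counted in
    \<open>patterns h\<close>.\<close>
  have below: "\<psi> a \<in> C h" if aN: "a \<in> N" for a
  proof -
    obtain k1 where k1: "k1 \<in> K" "{a, k1} \<in> edges H" using aN by (auto simp: N_def boundary_def)
    obtain xs where xs: "is_path HK xs" "hd xs = k0" "last xs = k1" using pathK k0(1) k1(1) by blast
    note len = path_len[OF xs(1)]
    let ?w = "\<psi> a0 # map \<psi> xs @ [\<psi> a]"
    have "hd ?w \<in> reach rk E' (last ?w) (length ?w - 1)"
    proof (rule walk_in_reach)
      have "successively (\<lambda>u v. {u, v} \<in> E') (map \<psi> xs)"
        by (rule successively_mono[OF path_walk[OF xs(1)]]) (use inner_sub in auto)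
      thus "successively (\<lambda>u v. {u, v} \<in> E') ?w"
        using embedding_edge[OF emb k1(2)] embedding_edge[OF emb k0(2)] len xs
        by (auto simp: successively_append_iff successively_Cons hd_append hd_map last_map insert_commute)
      fix v assume "v \<in> set ?w"
      then consider "v = \<psi> a0" | "v = \<psi> a" | k where "k \<in> K" "v = \<psi> k" using len by auto
      thus "v = last ?w \<or> rk (last ?w) < rk v"
      proof cases
        case 1
        have "\<psi> a \<in> V" using aN NA A embedding_verts[OF emb] by blast
        thus ?thesis using 1 a0(2)[OF aN] inj_onD[OF rk_inj, of "\<psi> a" "\<psi> a0"] hV
          by (auto simp: h_def)
      next
        case 3
        thus ?thesis using above[OF aN] by simp
      qed simp
    qed simp
    moreover have "length ?w - 1 \<le> r" using len cardK by simp
    ultimately have "hd ?w \<in> reach rk E (last ?w) r" using E'_sub by (rule reachD_mono)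
    thus ?thesis by (simp add: C_def h_def)
  qed
  have pat: "(K, \<phi>, k0) \<in> patterns h"
    using KV k0 below by (auto simp: patterns_def \<phi>_def N_def PiE_def)
  have edge_cover: "e \<subseteq> K \<union> N" if e: "e \<in> edges H" "e \<inter> K \<noteq> {}" for e
  proof -
    obtain x y where xy: "e = {x, y}" using e H(1) unfolding simple_graph_def by blast
    hence "e = {x, y} \<and> x \<in> K \<or> e = {y, x} \<and> y \<in> K" using e by auto
    then obtain u v where uv: "e = {u, v}" "u \<in> K" by blast
    moreover have "v \<in> verts H" using simple_edge(2)[OF H(1)] e uv by blast
    ultimately have "v \<in> K \<union> N" using e by (auto simp: N_def boundary_def insert_commute)
    thus ?thesis using uv by blast
  qed
  have edge_image: "(\<lambda>u. if u \<in> K then \<theta> u else \<phi> u) ` e = (\<lambda>u. if u \<in> K then \<theta> u else \<psi> u) ` e"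
    if "e \<in> edges H" "e \<inter> K \<noteq> {}" for e \<theta>
    by (rule image_cong) (use edge_cover[OF that] in \<open>auto simp: \<phi>_def\<close>)
  \<comment> \<open>The copy at hand is itself an extension, so its pattern has survived the
    pruning. A heavy vertex in a forbidden place would be a target excluded by
    \<open>closed\<close>.\<close>
  have att: "attaches E' (Z h) K \<phi> k0 \<psi>"
    unfolding attaches_def
  proof (intro conjI ballI impI)
    show "inj_on \<psi> K" using emb KV unfolding embedding_def by (blast intro: inj_on_subset)
    show "\<psi> ` K \<subseteq> V" by fact
    show "(\<lambda>u. if u \<in> K then \<psi> u else \<phi> u) ` e \<in> E'" if "e \<in> edges H" "e \<inter> K \<noteq> {}" for e
      using edge_image[OF that, of \<psi>] emb that by (simp add: embedding_def)
    show "\<psi> k \<notin> Z h" if "k \<in> K" "\<psi> k0 \<in> reach rk (inner_edges H K \<psi>) (\<psi> k) (r - 1)" for k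
    proof
      assume "\<psi> k \<in> Z h"
      moreover have "\<psi> k0 \<in> steps E' h (\<psi> k) (r - 1)"
        using reachD_mono[OF that(2) order_refl inner_sub] embedding_edge[OF emb k0(2)]
        by (simp add: steps_def h_def)
      ultimately show False using closed[OF a0A(1), of k] that(1) KV by (auto simp: h_def)
    qed
  qed
  define X0 where "X0 = extensions E' h K \<phi> k0"
  have X0: "\<psi> k0 \<in> X0" using att embedding_edge[OF emb k0(2)] by (auto simp: X0_def extensions_def h_def)
  hence dX0: "deg h \<le> D2 * card X0" using extensions_many[OF hV pat] by (auto simp: X0_def)
  have X0n: "X0 \<subseteq> neighbours G h" unfolding X0_def by (rule extensions_subset[OF E'_sub])
  have finX0: "finite X0" using X0n finite_neighbours finite_subset by blast
  have "\<forall>x\<in>X0. \<exists>\<theta>. \<theta> k0 = x \<and> attaches E' (Z h) K \<phi> k0 \<theta>" by (auto simp: X0_def extensions_def)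
  then obtain \<Theta> where \<Theta>: "\<And>x. x \<in> X0 \<Longrightarrow> \<Theta> x k0 = x \<and> attaches E' (Z h) K \<phi> k0 (\<Theta> x)" by metis
  \<comment> \<open>Undiscovered vertices outside \<open>K\<close> keep their images too, so they
    have to be avoided along with \<open>A\<close>.\<close>
  define W where "W = \<psi> ` (verts H - K)"
  have WV: "W \<subseteq> V" using embedding_verts[OF emb] by (auto simp: W_def)
  have finW: "finite W" using finite_H by (simp add: W_def)
  have cardW: "card W \<le> r"
    using card_image_le[of "verts H - K" \<psi>] card_mono[OF finite_H, of "verts H - K"] finite_H H(3)
    by (auto simp: W_def)
  define Bad where "Bad = {x \<in> X0. \<Theta> x ` K \<inter> W \<noteq> {}}"
  let ?hit = "\<lambda>m. {x \<in> neighbours G h. x \<in> reach rk E m r}"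
  have Bad_sub: "Bad \<subseteq> (\<Union>w\<in>W. \<Union>m\<in>C w - Z h. ?hit m)"
  proof
    fix x assume x: "x \<in> Bad"
    hence xX: "x \<in> X0" by (simp add: Bad_def)
    from x obtain k where k: "k \<in> K" "\<Theta> x k \<in> W" by (auto simp: Bad_def)
    have at: "attaches E' (Z h) K \<phi> k0 (\<Theta> x)" and x0: "\<Theta> x k0 = x" using \<Theta>[OF xX] by auto
    have "\<Theta> x ` K \<subseteq> V" using at by (simp add: attaches_def)
    from meet[OF this k0(1) k(1)] obtain b where b: "b \<in> K"
      "\<Theta> x k0 \<in> reach rk (inner_edges H K (\<Theta> x)) (\<Theta> x b) (r - 1)"
      "\<Theta> x k \<in> reach rk (inner_edges H K (\<Theta> x)) (\<Theta> x b) (r - 1)" by blast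
    have sub: "inner_edges H K (\<Theta> x) \<subseteq> E"
    proof
      fix f assume "f \<in> inner_edges H K (\<Theta> x)"
      then obtain e where e: "e \<in> edges H" "e \<subseteq> K" "f = \<Theta> x ` e" by (auto simp: inner_edges_def)
      hence "e \<noteq> {}" using H(1) by (auto simp: simple_graph_def)
      hence "(\<lambda>u. if u \<in> K then \<Theta> x u else \<phi> u) ` e \<in> E'" using at e by (auto simp: attaches_def)
      moreover have "(\<lambda>u. if u \<in> K then \<Theta> x u else \<phi> u) ` e = f" using e by (auto intro!: image_cong)
      ultimately show "f \<in> E" using E'_sub by auto
    qed
    have "\<Theta> x b \<notin> Z h" using at b unfolding attaches_def by blast
    moreover have "\<Theta> x b \<in> C (\<Theta> x k)" using reachD_mono[OF b(3) _ sub, of r] by (simp add: C_def)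
    moreover have "x \<in> ?hit (\<Theta> x b)" using reachD_mono[OF b(2) _ sub, of r] x0 xX X0n by auto
    ultimately show "x \<in> (\<Union>w\<in>W. \<Union>m\<in>C w - Z h. ?hit m)" using k by blast
  qed
  have finhit: "finite (?hit m)" for m using finite_neighbours by simp
  have finC: "finite (C w - Z h)" if "w \<in> W" for w using finite_C WV that by auto
  have "card Bad \<le> card (\<Union>w\<in>W. \<Union>m\<in>C w - Z h. ?hit m)"
    by (rule card_mono[OF _ Bad_sub]) (use finW finC finhit in blast)
  also have "\<dots> \<le> (\<Sum>w\<in>W. card (\<Union>m\<in>C w - Z h. ?hit m))" by (rule card_UN_le[OF finW])
  also have "\<dots> \<le> (\<Sum>w\<in>W. \<Sum>m\<in>C w - Z h. card (?hit m))"
    by (intro sum_mono card_UN_le finC)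
  finally have "D * card Bad \<le> D * real (\<Sum>w\<in>W. \<Sum>m\<in>C w - Z h. card (?hit m))"
    using D_pos by (intro mult_left_mono of_nat_mono) auto
  also have "\<dots> = (\<Sum>w\<in>W. \<Sum>m\<in>C w - Z h. D * card (?hit m))" by (simp add: sum_distrib_left)
  also have "\<dots> \<le> (\<Sum>w\<in>W. \<Sum>m\<in>C w - Z h. real (deg h))"
  proof (intro sum_mono)
    fix w m assume "w \<in> W" "m \<in> C w - Z h"
    hence "m \<in> V" "m \<notin> Z h" using C_subset WV by auto
    thus "D * card (?hit m) \<le> real (deg h)" by (simp add: Z_def)
  qed
  also have "\<dots> \<le> (\<Sum>w\<in>W. c * real (deg h))"
  proof (rule sum_mono)
    fix w assume w: "w \<in> W"
    have "card (C w - Z h) \<le> c"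
      using card_mono[OF finite_C, of w "C w - Z h"] card_C[of w] w WV by fastforce
    thus "(\<Sum>m\<in>C w - Z h. real (deg h)) \<le> c * real (deg h)" by (simp add: mult_right_mono)
  qed
  also have "\<dots> \<le> r * (c * real (deg h))" using cardW by (simp add: mult_right_mono)
  finally have "(r * c) * (2 * D2 * card Bad) \<le> (r * c) * real (deg h)" by (simp add: D_def mult_ac)
  hence bad: "2 * D2 * card Bad \<le> deg h" using r_pos c_ge_1 by (subst (asm) mult_le_cancel_left_pos) auto
  define X where "X = X0 - Bad"
  have "Bad \<subseteq> X0" by (auto simp: Bad_def)
  hence "real (card X) = real (card X0) - real (card Bad)"
    using finX0 by (simp add: X_def card_Diff_subset finite_subset card_mono of_nat_diff)
  hence "2 * D2 * card X = 2 * D2 * card X0 - 2 * D2 * card Bad" by (simp add: right_diff_distrib)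
  hence "deg h \<le> 2 * D2 * card X" using dX0 bad by linarith
  \<comment> \<open>The factor 2 in \<open>delta_ge\<close> pays for the half of the extensions that
    collisions may spoil.\<close>
  also have "\<dots> \<le> \<delta> * card X" using delta_ge by (intro mult_right_mono) auto
  finally have dX: "deg h \<le> \<delta> * card X" .
  have "deg h > 0" using X0 X0n finite_neighbours[of h] by (auto simp: card_gt_0_iff)
  hence "X \<noteq> {}" using dX by auto
  moreover have "X \<subseteq> neighbours G h" using X0n by (auto simp: X_def)
  moreover have "\<exists>\<psi>'. embedding H E' \<psi>' \<and> (\<forall>u\<in>A. \<psi>' u = \<psi> u) \<and> \<psi>' k0 = x" if x: "x \<in> X" for x
  proof (intro exI conjI)
    let ?p = "\<lambda>u. if u \<in> K then \<Theta> x u else \<psi> u"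
    have xX: "x \<in> X0" and nb: "\<Theta> x ` K \<inter> W = {}" using x by (auto simp: X_def Bad_def)
    have at: "attaches E' (Z h) K \<phi> k0 (\<Theta> x)" and x0: "\<Theta> x k0 = x" using \<Theta>[OF xX] by auto
    show "\<forall>u\<in>A. ?p u = \<psi> u" using KV by auto
    show "?p k0 = x" using x0 k0 by simp
    show "embedding H E' ?p"
      unfolding embedding_def
    proof (intro conjI ballI)
      show "inj_on ?p (verts H)"
      proof (rule inj_onI)
        fix u v assume uv: "u \<in> verts H" "v \<in> verts H" "?p u = ?p v"
        show "u = v"
        proof (cases "u \<in> K"; cases "v \<in> K")
          assume "u \<in> K" "v \<in> K" thus ?thesis using uv at by (auto simp: attaches_def inj_on_def)
        next
          assume "u \<in> K" "v \<notin> K" thus ?thesis using uv nb by (force simp: W_def)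
        next
          assume "u \<notin> K" "v \<in> K" thus ?thesis using uv nb by (force simp: W_def)
        next
          assume "u \<notin> K" "v \<notin> K" thus ?thesis using uv embedding_inj[OF emb] by auto
        qed
      qed
      fix e assume e: "e \<in> edges H"
      show "?p ` e \<in> E'"
      proof (cases "e \<inter> K = {}")
        case True
        hence "?p ` e = \<psi> ` e" by (intro image_cong) auto
        thus ?thesis using emb e by (simp add: embedding_def)
      next
        case False
        hence "(\<lambda>u. if u \<in> K then \<Theta> x u else \<phi> u) ` e \<in> E'"
          using at e unfolding attaches_def by blast
        thus ?thesis by (simp only: edge_image[OF e False])
      qed
    qed
  qed
  ultimately show ?thesis using a0A(1) k0(1) KV dX unfolding h_def by blast
qed

end

section \<open>Random exploration\<close>

definition extends :: "'a ugraph \<times> nat \<Rightarrow> 'a ugraph \<times> nat \<Rightarrow> bool" where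
  "extends st st' \<longleftrightarrow> verts (fst st) \<subseteq> verts (fst st') \<and> edges (fst st) \<subseteq> edges (fst st')"

definition valid_state :: "'a ugraph \<Rightarrow> 'a ugraph \<times> nat \<Rightarrow> bool" where
  "valid_state G st \<longleftrightarrow> finite (verts (fst st)) \<and> verts (fst st) \<subseteq> verts G \<and> edges (fst st) \<subseteq> edges G"

lemma extends_refl [simp]: "extends st st" by (simp add: extends_def)

lemma extends_trans: "extends a b \<Longrightarrow> extends b c \<Longrightarrow> extends a c" by (auto simp: extends_def)

text \<open>The edge is recorded along with the vertex: for a singleton \<open>X\<close> the event
  says that a prescribed edge has been explored.\<close>

definition hit :: "'a \<Rightarrow> 'a set \<Rightarrow> 'a ugraph \<times> nat \<Rightarrow> bool" where
  "hit v X st \<longleftrightarrow> (\<exists>x\<in>X. x \<in> verts (fst st) \<and> {v, x} \<in> edges (fst st))"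

lemma hit_mono: "hit v X st \<Longrightarrow> extends st st' \<Longrightarrow> hit v X st'"
  by (auto simp: hit_def extends_def)

text \<open>With \<open>a = 1\<close> this is a union bound, where \<open>B\<close> is failure of
  the first stage and \<open>b\<close> the error of the second. With \<open>b = 0\<close> it is a
  product bound for repeated independent trials.\<close>

lemma prob_bind_le:
  fixes a b :: real
  assumes "\<And>x. x \<in> set_pmf p \<Longrightarrow> measure_pmf.prob (f x) S \<le> a * indicator B x + b" "0 \<le> a" "0 \<le> b"
  shows "measure_pmf.prob (p \<bind> f) S \<le> a * measure_pmf.prob p B + b"
proof -
  have "emeasure (measure_pmf (p \<bind> f)) S = (\<integral>\<^sup>+x. emeasure (f x) S \<partial>p)" by simp
  also have "\<dots> \<le> (\<integral>\<^sup>+x. ennreal a * indicator B x + ennreal b \<partial>p)"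
  proof (rule nn_integral_mono_AE, rule AE_pmfI)
    fix x assume "x \<in> set_pmf p"
    from assms(1)[OF this] have "ennreal (measure_pmf.prob (f x) S) \<le> ennreal (a * indicator B x + b)"
      by (rule ennreal_leI)
    thus "emeasure (f x) S \<le> ennreal a * indicator B x + ennreal b"
      using assms(2,3) by (auto simp: measure_pmf.emeasure_eq_measure indicator_def split: if_splits)
  qed
  also have "\<dots> = ennreal (a * measure_pmf.prob p B + b)"
    using assms(2,3)
    by (simp add: nn_integral_add nn_integral_cmult measure_pmf.emeasure_eq_measure ennreal_mult)
  finally show ?thesis
    using assms(2,3) by (simp add: measure_pmf.emeasure_eq_measure del: ennreal_plus)
qed

lemma set_pmf_oracle:
  assumes "finite (verts G)"
  shows "set_pmf (random_neighbour_oracle G v) \<subseteq> insert None (Some ` neighbours G v)"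
proof -
  have "finite (neighbours G v)" using assms by (simp add: neighbours_def)
  thus ?thesis by (auto simp: random_neighbour_oracle_def)
qed

section \<open>Single queries\<close>

context
  fixes G :: "'a ugraph"
  assumes fin: "finite (verts G)"
begin

abbreviation (input) "orc \<equiv> random_neighbour_oracle G"

lemma query_support:
  assumes "st' \<in> set_pmf (query orc v st)" "valid_state G st"
  shows "valid_state G st'" "extends st st'" "card (verts (fst st')) \<le> Suc (card (verts (fst st)))"
    "snd st' = Suc (snd st)"
proof -
  obtain K q where st: "st = (K, q)" by (cases st)
  from assms(1) obtain a where a: "a \<in> set_pmf (orc v)" "st' = (record_answer v a K, Suc q)"
    by (auto simp: query_def st)
  consider "a = None" | u where "a = Some u" "u \<in> neighbours G v"
    using a(1) set_pmf_oracle[OF fin, of v] by auto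
  hence "valid_state G st' \<and> extends st st' \<and> card (verts (fst st')) \<le> Suc (card (verts (fst st)))"
  proof cases
    case 2
    thus ?thesis using assms(2) a st
      by (auto simp: valid_state_def extends_def neighbours_def card_insert_if)
  qed (use assms(2) a st in \<open>simp_all add: valid_state_def extends_def\<close>)
  thus "valid_state G st'" "extends st st'" "card (verts (fst st')) \<le> Suc (card (verts (fst st)))"
    by auto
  show "snd st' = Suc (snd st)" using a st by simp
qed

lemma query_list_support:
  assumes "st' \<in> set_pmf (query_list orc vs st)" "valid_state G st"
  shows "valid_state G st' \<and> extends st st' \<and>
    card (verts (fst st')) \<le> length vs + card (verts (fst st)) \<and> snd st' = length vs + snd st"
  using assms
proof (induction vs arbitrary: st)
  case (Cons v vs)
  then obtain s1 where s1: "s1 \<in> set_pmf (query orc v st)" "st' \<in> set_pmf (query_list orc vs s1)" by auto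
  note q = query_support[OF s1(1) Cons.prems(2)]
  from Cons.IH[OF s1(2) q(1)] q show ?case by (auto intro: extends_trans)
qed simp

lemma miss_query:
  fixes Q :: real
  assumes X: "X \<subseteq> neighbours G v" "X \<noteq> {}" "card (neighbours G v) \<le> Q * card X"
  shows "measure_pmf.prob (orc v) {a. a \<notin> Some ` X} \<le> 1 - 1 / Q"
proof -
  have fn: "finite (neighbours G v)" using fin by (simp add: neighbours_def)
  have ne: "neighbours G v \<noteq> {}" using X by auto
  have pos: "real (card (neighbours G v)) > 0" using fn ne by (simp add: card_gt_0_iff)
  have cX: "real (card X) > 0" using X fn by (simp add: card_gt_0_iff finite_subset)
  have Q: "Q > 0"
    using less_le_trans[OF pos X(3)] cX by (simp add: zero_less_mult_iff)
  have "measure_pmf.prob (orc v) {a. a \<notin> Some ` X} =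
      measure_pmf.prob (pmf_of_set (neighbours G v)) (Some -` {a. a \<notin> Some ` X})"
    using ne by (simp add: random_neighbour_oracle_def)
  also have "\<dots> = card (neighbours G v - X) / card (neighbours G v)"
    using ne fn by (subst measure_pmf_of_set) (auto intro!: arg_cong[where f = card])
  also have "card (neighbours G v - X) = card (neighbours G v) - card X"
    using X fn by (intro card_Diff_subset) (auto intro: finite_subset)
  also have "real \<dots> = real (card (neighbours G v)) - real (card X)"
    using X fn by (intro of_nat_diff card_mono)
  also have "(real (card (neighbours G v)) - real (card X)) / card (neighbours G v) \<le> 1 - 1 / Q"
    using pos X(3) Q by (simp add: field_simps)
  finally show ?thesis .
qed

text \<open>Every query of \<open>v\<close> draws a fresh answer and contributes a factor
  \<open>1 - 1 / Q\<close>. Other queries cannot undo a success, because the explored graph only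
  grows.\<close>

lemma miss_query_list:
  fixes Q :: real
  assumes X: "X \<subseteq> neighbours G v" "X \<noteq> {}" "card (neighbours G v) \<le> Q * card X"
    and "valid_state G st"
  shows "measure_pmf.prob (query_list orc vs st) {st'. \<not> hit v X st'} \<le> (1 - 1 / Q) ^ count_list vs v"
  using assms(4)
proof (induction vs arbitrary: st)
  case (Cons w vs)
  let ?M = "\<lambda>st. measure_pmf.prob (query_list orc vs st) {st'. \<not> hit v X st'}"
  \<comment> \<open>An upper bound for a probability is nonnegative.\<close>
  have nn: "0 \<le> 1 - 1 / Q"
    using miss_query[OF X] measure_nonneg order_trans by blast
  have IH: "?M s1 \<le> (1 - 1 / Q) ^ count_list vs v" if "s1 \<in> set_pmf (query orc w st)" for s1
    using Cons.IH query_support(1)[OF that Cons.prems] .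
  show ?case
  proof (cases "w = v")
    case False
    have "measure_pmf.prob (query orc w st \<bind> query_list orc vs) {st'. \<not> hit v X st'}
        \<le> 0 * measure_pmf.prob (query orc w st) {} + (1 - 1 / Q) ^ count_list vs v"
      by (rule prob_bind_le) (use IH nn in auto)
    thus ?thesis using False by simp
  next
    case True
    let ?B = "{s1. \<not> hit v X s1}"
    have "measure_pmf.prob (query orc w st) ?B \<le> measure_pmf.prob (orc v) {a. a \<notin> Some ` X}"
    proof -
      have "measure_pmf.prob (query orc w st) ?B
          = measure_pmf.prob (orc v) ((\<lambda>a. (record_answer v a (fst st), Suc (snd st))) -` ?B)"
        using True by (simp add: query_def map_pmf_def[symmetric])
      also have "\<dots> \<le> measure_pmf.prob (orc v) {a. a \<notin> Some ` X}"
        by (rule measure_pmf.finite_measure_mono) (auto simp: hit_def)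
      finally show ?thesis .
    qed
    also have "\<dots> \<le> 1 - 1 / Q" by (rule miss_query[OF X])
    finally have q: "measure_pmf.prob (query orc w st) ?B \<le> 1 - 1 / Q" .
    have "measure_pmf.prob (query orc w st \<bind> query_list orc vs) {st'. \<not> hit v X st'}
        \<le> (1 - 1 / Q) ^ count_list vs v * measure_pmf.prob (query orc w st) ?B + 0"
    proof (rule prob_bind_le)
      fix s1 assume s1: "s1 \<in> set_pmf (query orc w st)"
      show "?M s1 \<le> (1 - 1 / Q) ^ count_list vs v * indicator ?B s1 + 0"
      proof (cases "s1 \<in> ?B")
        case False
        have "hit v X st'" if "st' \<in> set_pmf (query_list orc vs s1)" for st'
          using query_list_support[OF that query_support(1)[OF s1 Cons.prems]] hit_mono[of v X s1 st'] False by auto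
        hence "?M s1 = 0" by (auto simp: measure_pmf_zero_iff)
        thus ?thesis using False by simp
      qed (use IH[OF s1] in simp)
    qed (use nn in auto)
    also have "\<dots> \<le> (1 - 1 / Q) ^ count_list vs v * (1 - 1 / Q)"
      using q nn by (simp add: mult_left_mono)
    finally show ?thesis using True by (simp add: mult.commute)
  qed
qed simp

end

section \<open>Rounds of the exploration and their failure probabilities\<close>

lemma count_list_concat_replicate:
  "distinct vs \<Longrightarrow> count_list (concat (map (replicate k) vs)) v = (if v \<in> set vs then k else 0)"
proof (induction vs)
  case (Cons w vs)
  have "count_list (replicate k w) v = (if w = v then k else 0)" by (induction k) auto
  with Cons show ?case by auto
qed simp

abbreviation (input) run :: "nat ugraph \<Rightarrow> nat \<Rightarrow> nat \<Rightarrow> nat ugraph \<times> nat \<Rightarrow> (nat ugraph \<times> nat) pmf" where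
  "run G \<equiv> explore (random_neighbour_oracle G)"

text \<open>\<open>a\<close> bounds the probability of failure, so that rounds and errors both add
  up under composition.\<close>

definition achieves ::
  "nat ugraph \<Rightarrow> nat \<Rightarrow> nat \<Rightarrow> real \<Rightarrow> (nat ugraph \<times> nat \<Rightarrow> bool) \<Rightarrow> nat ugraph \<times> nat \<Rightarrow> bool" where
  "achieves G k s a P st \<longleftrightarrow> measure_pmf.prob (run G k s st) {st'. \<not> P st'} \<le> a"

context
  fixes G :: "nat ugraph" and k :: nat
  assumes fin: "finite (verts G)"
begin

lemma run_add: "run G k (s + t) st = run G k s st \<bind> run G k t"
  by (induction t) (simp_all add: bind_return_pmf' bind_assoc_pmf)

lemma round_support:
  assumes "st' \<in> set_pmf (explore_round (random_neighbour_oracle G) k st)" "valid_state G st"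
  shows "valid_state G st' \<and> extends st st' \<and>
    card (verts (fst st')) \<le> card (verts (fst st)) * k + card (verts (fst st)) \<and>
    snd st' = card (verts (fst st)) * k + snd st"
proof -
  have "finite (verts (fst st))" using assms(2) by (simp add: valid_state_def)
  hence "length (concat (map (replicate k) (sorted_list_of_set (verts (fst st))))) = card (verts (fst st)) * k"
    by (simp add: length_concat o_def sum_list_triv)
  with query_list_support[OF fin assms(1)[unfolded explore_round_def] assms(2)] show ?thesis by simp
qed

lemma run_support:
  assumes "st' \<in> set_pmf (run G k s st)" "valid_state G st"
  shows "valid_state G st' \<and> extends st st'"
  using assms(1)
proof (induction s arbitrary: st')
  case (Suc s)
  then obtain s1 where "s1 \<in> set_pmf (run G k s st)"
    "st' \<in> set_pmf (explore_round (random_neighbour_oracle G) k s1)" by auto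
  with Suc.IH[of s1] round_support[of st' s1] show ?case by (auto intro: extends_trans)
qed (use assms(2) in simp)

text \<open>Each vertex contributes at most \<open>k\<close> new ones per round, so the number of
  vertices grows by a factor of at most \<open>k + 1\<close>, whatever the size of \<open>G\<close>.
  The factor \<open>s\<close> is a crude bound for the geometric sum.\<close>

lemma run_queries:
  assumes "st' \<in> set_pmf (run G k s st)" "valid_state G st"
  shows "card (verts (fst st')) \<le> card (verts (fst st)) * (k + 1) ^ s \<and>
     snd st' \<le> s * (card (verts (fst st)) * (k + 1) ^ s * k) + snd st"
  using assms(1)
proof (induction s arbitrary: st')
  case (Suc s)
  then obtain s1 where s1: "s1 \<in> set_pmf (run G k s st)"
    "st' \<in> set_pmf (explore_round (random_neighbour_oracle G) k s1)" by auto
  let ?c = "card (verts (fst st))" and ?c1 = "card (verts (fst s1))"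
  note sup = round_support[OF s1(2)] run_support[OF s1(1) assms(2)]
  have IH: "?c1 \<le> ?c * (k + 1) ^ s" "snd s1 \<le> s * (?c * (k + 1) ^ s * k) + snd st"
    using Suc.IH[OF s1(1)] by auto
  have "card (verts (fst st')) \<le> ?c1 * (k + 1)" using sup by simp
  also have "\<dots> \<le> ?c * (k + 1) ^ s * (k + 1)" using IH(1) by (rule mult_right_mono) simp
  finally have 1: "card (verts (fst st')) \<le> ?c * (k + 1) ^ Suc s" by (simp only: power_Suc mult_ac)
  have le: "?c * (k + 1) ^ s * k \<le> ?c * (k + 1) ^ Suc s * k"
    by (intro mult_right_mono mult_left_mono power_increasing) auto
  have "snd st' = ?c1 * k + snd s1" using sup by simp
  also have "?c1 * k \<le> ?c * (k + 1) ^ s * k" using IH(1) by (rule mult_right_mono) simp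
  also note le
  also have "snd s1 \<le> s * (?c * (k + 1) ^ Suc s * k) + snd st"
    using IH(2) mult_left_mono[OF le, of s] by linarith
  finally have "snd st' \<le> Suc s * (?c * (k + 1) ^ Suc s * k) + snd st" by simp
  with 1 show ?case by blast
qed simp

lemma miss_round:
  fixes Q :: real
  assumes "X \<subseteq> neighbours G v" "X \<noteq> {}" "card (neighbours G v) \<le> Q * card X"
    and "valid_state G st" "v \<in> verts (fst st)"
  shows "measure_pmf.prob (run G k 1 st) {st'. \<not> hit v X st'} \<le> (1 - 1 / Q) ^ k"
proof -
  have "finite (verts (fst st))" using assms(4) by (simp add: valid_state_def)
  thus ?thesis
    using miss_query_list[OF fin assms(1-4), of "concat (map (replicate k) (sorted_list_of_set (verts (fst st))))"]
      assms(5)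
    by (simp add: explore_round_def bind_return_pmf count_list_concat_replicate)
qed

text \<open>A union bound over the two stages. The second one has to be analysed only from valid
  extensions of \<open>st\<close>, since other states have probability zero.\<close>

lemma achieves_seq:
  assumes "achieves G k s a P st" "valid_state G st" "0 \<le> b"
    and "\<And>st'. valid_state G st' \<Longrightarrow> extends st st' \<Longrightarrow> P st' \<Longrightarrow> achieves G k t b Q st'"
  shows "achieves G k (s + t) (a + b) Q st"
proof -
  have "measure_pmf.prob (run G k s st \<bind> run G k t) {st'. \<not> Q st'} \<le>
      1 * measure_pmf.prob (run G k s st) {st'. \<not> P st'} + b"
  proof (rule prob_bind_le)
    fix st' assume "st' \<in> set_pmf (run G k s st)"
    note sup = run_support[OF this assms(2)]
    show "measure_pmf.prob (run G k t st') {st'. \<not> Q st'} \<le> 1 * indicator {st'. \<not> P st'} st' + b"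
    proof (cases "P st'")
      case True
      thus ?thesis using assms(4) sup by (simp add: achieves_def)
    next
      case False
      thus ?thesis using assms(3) by (intro order_trans[OF measure_pmf.prob_le_1]) simp
    qed
  qed (use assms(3) in auto)
  thus ?thesis using assms(1) by (simp add: achieves_def run_add)
qed

lemma achieves_holds:
  assumes "P st" "valid_state G st" "\<And>st'. extends st st' \<Longrightarrow> P st'" "0 \<le> a"
  shows "achieves G k s a P st"
proof -
  have "measure_pmf.prob (run G k s st) {st'. \<not> P st'} = 0"
    using assms(3) run_support[OF _ assms(2)] by (auto simp: measure_pmf_zero_iff)
  thus ?thesis using assms(4) by (simp add: achieves_def)
qed

lemma achieves_pad:
  assumes "achieves G k s a P st" "valid_state G st" "s \<le> t" "a \<le> b"
    and "\<And>st1 st2. P st1 \<Longrightarrow> extends st1 st2 \<Longrightarrow> P st2"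
  shows "achieves G k t b P st"
proof -
  have "achieves G k (s + (t - s)) (a + 0) P st"
    by (rule achieves_seq[OF assms(1,2)]) (use assms(5) achieves_holds in blast)+
  thus ?thesis using assms(3,4) by (simp add: achieves_def)
qed

end

lemma achieves_weaken:
  assumes "achieves G k s a P st" "\<And>st. P st \<Longrightarrow> Q st"
  shows "achieves G k s a Q st"
proof -
  have "measure_pmf.prob (run G k s st) {st'. \<not> Q st'} \<le> measure_pmf.prob (run G k s st) {st'. \<not> P st'}"
    by (rule measure_pmf.finite_measure_mono) (use assms(2) in auto)
  thus ?thesis using assms(1) by (simp add: achieves_def)
qed

section \<open>Copies as injective maps\<close>

lemma contains_copyI:
  assumes H: "simple_graph H" and "inj_on \<psi> (verts H)" "\<psi> ` verts H \<subseteq> verts K" "\<forall>e\<in>edges H. \<psi> ` e \<in> edges K"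
  shows "contains_copy H K"
proof -
  \<comment> \<open>\<open>isomorphic\<close> demands an equivalence of adjacencies, so
    \<open>S\<close> receives only the images of edges of \<open>H\<close>; further edges of
    \<open>K\<close> between these vertices are left out.\<close>
  define S where "S = UGraph (\<psi> ` verts H) ((\<lambda>e. \<psi> ` e) ` edges H)"
  have sub: "\<And>e. e \<in> edges H \<Longrightarrow> e \<subseteq> verts H" using H by (auto simp: simple_graph_def)
  have "simple_graph S"
    unfolding simple_graph_def
  proof
    show "finite (verts S)" using H by (simp add: S_def simple_graph_def)
    show "edges S \<subseteq> {{u, v} |u v. u \<in> verts S \<and> v \<in> verts S \<and> u \<noteq> v}"
    proof
      fix f assume "f \<in> edges S"
      then obtain e where e: "e \<in> edges H" "f = \<psi> ` e" by (auto simp: S_def)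
      then obtain u v where "e = {u, v}" "u \<in> verts H" "v \<in> verts H" "u \<noteq> v"
        using H unfolding simple_graph_def by blast
      moreover from this have "\<psi> u \<noteq> \<psi> v" using assms(2) by (auto simp: inj_on_def)
      ultimately show "f \<in> {{u, v} |u v. u \<in> verts S \<and> v \<in> verts S \<and> u \<noteq> v}"
        using e by (auto simp: S_def)
    qed
  qed
  hence "subgraph S K" using assms(3,4) by (auto simp: subgraph_def S_def)
  moreover have "isomorphic H S"
    unfolding isomorphic_def
  proof (intro exI[of _ \<psi>] conjI ballI)
    show "bij_betw \<psi> (verts H) (verts S)" using assms(2) by (simp add: S_def bij_betw_def)
    fix u v assume uv: "u \<in> verts H" "v \<in> verts H"
    show "{u, v} \<in> edges H \<longleftrightarrow> {\<psi> u, \<psi> v} \<in> edges S"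
    proof
      assume "{\<psi> u, \<psi> v} \<in> edges S"
      then obtain e where e: "e \<in> edges H" "\<psi> ` {u, v} = \<psi> ` e" by (auto simp: S_def)
      hence "{u, v} = e" using inj_on_image_eq_iff[OF assms(2), of "{u, v}" e] uv sub by simp
      thus "{u, v} \<in> edges H" using e by simp
    next
      assume "{u, v} \<in> edges H"
      hence "\<psi> ` {u, v} \<in> edges S" unfolding S_def by (auto simp del: image_insert)
      thus "{\<psi> u, \<psi> v} \<in> edges S" by simp
    qed
  qed
  ultimately show ?thesis by (auto simp: contains_copy_def)
qed

lemma contains_copyD:
  assumes H: "simple_graph H" and "contains_copy H K"
  shows "\<exists>\<psi>. embedding H (edges K) \<psi> \<and> \<psi> ` verts H \<subseteq> verts K"
proof -
  obtain S \<psi> where S: "subgraph S K" "bij_betw \<psi> (verts H) (verts S)"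
    "\<forall>u\<in>verts H. \<forall>v\<in>verts H. {u, v} \<in> edges H \<longleftrightarrow> {\<psi> u, \<psi> v} \<in> edges S"
    using assms(2) by (auto simp: contains_copy_def isomorphic_def)
  have "\<psi> ` e \<in> edges K" if "e \<in> edges H" for e
  proof -
    have "\<exists>u v. e = {u, v} \<and> u \<in> verts H \<and> v \<in> verts H"
      using H that unfolding simple_graph_def by blast
    then obtain u v where "e = {u, v}" "u \<in> verts H" "v \<in> verts H" by blast
    thus ?thesis using S(1,3) that by (auto simp: subgraph_def)
  qed
  thus ?thesis using S by (intro exI[of _ \<psi>]) (auto simp: embedding_def bij_betw_def subgraph_def)
qed

lemma contains_copy_mono:
  "contains_copy H K \<Longrightarrow> verts K \<subseteq> verts K' \<Longrightarrow> edges K \<subseteq> edges K' \<Longrightarrow> contains_copy H K'"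
  unfolding contains_copy_def subgraph_def by blast

section \<open>Growth of the discovered part of a copy\<close>

locale explored_graph = pruned_graph G R rk p r H \<epsilon> \<delta> E'
  for G :: "nat ugraph" and R rk p r and H :: "'b ugraph" and \<epsilon> \<delta> E' +
  fixes k :: nat
  assumes delta_ge_1: "1 \<le> \<delta>"
begin

text \<open>A bound on the probability that one round misses a set containing at least the fraction
  \<open>1 / \<delta>\<close> of the neighbours of a known vertex.\<close>

definition miss :: real where "miss = (1 - 1 / \<delta>) ^ k"

lemma miss_nonneg: "0 \<le> miss" using delta_ge_1 by (simp add: miss_def)

lemma achieves_steps:
  assumes "valid_state G st" "h \<in> verts (fst st)" "m \<in> Z h \<union> C h" "l < r" "steps E' h m l \<noteq> {}"
  shows "achieves G k 1 miss (hit h (steps E' h m l)) st"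
proof -
  have "h \<in> V" using assms by (auto simp: valid_state_def)
  from miss_round[OF finite_verts steps_subset[OF E'_sub] assms(5) steps_many[OF this assms(3-5)] assms(1,2)]
  show ?thesis unfolding achieves_def miss_def .
qed

text \<open>Only the target is fixed. The answer found need not lie on the walk that witnesses
  reachability, but it has a walk of its own to \<open>m\<close> that is one step shorter.\<close>

lemma achieves_reached:
  assumes "l \<le> r" "v \<in> reach rk E' m l" "valid_state G st" "v \<in> verts (fst st)"
  shows "achieves G k l (l * miss) (\<lambda>s. m \<in> verts (fst s)) st"
  using assms
proof (induction l arbitrary: v st)
  case 0
  thus ?case by (intro achieves_holds finite_verts) (auto simp: extends_def)
next
  case (Suc l)
  show ?case
  proof (cases "v \<in> reach rk E' m l")
    case True
    have "achieves G k l (l * miss) (\<lambda>s. m \<in> verts (fst s)) st"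
      by (rule Suc.IH) (use Suc.prems True in auto)
    thus ?thesis
      by (rule achieves_pad[OF finite_verts]) (use Suc.prems miss_nonneg in \<open>auto simp: extends_def algebra_simps\<close>)
  next
    case False
    then obtain x where x: "x \<in> steps E' v m l" using Suc.prems(2) by (auto simp: steps_def)
    have "v \<in> reach rk E m r" by (rule reachD_mono[OF Suc.prems(2,1) E'_sub])
    hence "m \<in> Z v \<union> C v" by (simp add: C_def)
    have "achieves G k 1 miss (hit v (steps E' v m l)) st"
      by (rule achieves_steps[OF Suc.prems(3,4) \<open>m \<in> Z v \<union> C v\<close>]) (use x Suc.prems(1) in auto)
    hence "achieves G k (1 + l) (miss + l * miss) (\<lambda>s. m \<in> verts (fst s)) st"
    proof (rule achieves_seq[OF finite_verts _ Suc.prems(3)])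
      fix st' assume st': "valid_state G st'" "hit v (steps E' v m l) st'"
      then obtain y where "y \<in> reach rk E' m l" "y \<in> verts (fst st')" by (auto simp: hit_def steps_def)
      thus "achieves G k l (l * miss) (\<lambda>s. m \<in> verts (fst s)) st'"
        using Suc.IH Suc.prems(1) st'(1) by simp
    qed (use miss_nonneg in simp)
    thus ?thesis by (simp add: algebra_simps)
  qed
qed

text \<open>The copy is existential: a later state may be certified by another embedding, in which
  the undiscovered part has been exchanged.\<close>

definition partial :: "'b set \<Rightarrow> nat ugraph \<times> nat \<Rightarrow> bool" where
  "partial A st \<longleftrightarrow> (\<exists>\<psi>. embedding H E' \<psi> \<and> \<psi> ` A \<subseteq> verts (fst st))"

lemma partial_extends: "partial A st \<Longrightarrow> extends st st' \<Longrightarrow> partial A st'"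
  unfolding partial_def extends_def by blast

text \<open>If some undiscovered vertex of the copy can be approached, one round makes the first
  step and \<open>r - 1\<close> rounds the others. If none can, a single round hits a replacement
  from \<open>many_extensions\<close>, and the other rounds merely preserve this, so that both cases
  have the same length.\<close>

lemma achieves_larger:
  assumes A: "A \<subseteq> verts H" "A \<noteq> {}" "A \<noteq> verts H" and "valid_state G st" "partial A st"
  shows "achieves G k r (r * miss) (\<lambda>s. \<exists>b\<in>verts H - A. partial (insert b A) s) st"
proof -
  obtain \<psi> where emb: "embedding H E' \<psi>" and found: "\<psi> ` A \<subseteq> verts (fst st)"
    using assms(5) by (auto simp: partial_def)
  show ?thesis
  proof (cases "\<exists>a\<in>A. \<exists>b\<in>verts H - A. \<psi> b \<in> Z (\<psi> a) \<union> C (\<psi> a) \<and> steps E' (\<psi> a) (\<psi> b) (r - 1) \<noteq> {}")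
    case True
    then obtain a b where ab: "a \<in> A" "b \<in> verts H - A" "\<psi> b \<in> Z (\<psi> a) \<union> C (\<psi> a)"
      "steps E' (\<psi> a) (\<psi> b) (r - 1) \<noteq> {}" by blast
    have r1: "r - 1 < r" using r_pos by simp
    have "\<psi> a \<in> verts (fst st)" using ab found by blast
    from achieves_steps[OF assms(4) this ab(3) r1 ab(4)]
    have "achieves G k (1 + (r - 1)) (miss + (r - 1) * miss) (\<lambda>s. \<psi> ` A \<subseteq> verts (fst s) \<and> \<psi> b \<in> verts (fst s)) st"
    proof (rule achieves_seq[OF finite_verts _ assms(4)])
      fix st' assume st': "valid_state G st'" "extends st st'" "hit (\<psi> a) (steps E' (\<psi> a) (\<psi> b) (r - 1)) st'"
      then obtain y where y: "y \<in> reach rk E' (\<psi> b) (r - 1)" "y \<in> verts (fst st')"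
        by (auto simp: hit_def steps_def)
      have "achieves G k (r - 1) ((r - 1) * miss) (\<lambda>s. \<psi> b \<in> verts (fst s)) st'"
        using achieves_reached[OF _ y(1) st'(1) y(2)] by simp
      hence "measure_pmf.prob (run G k (r - 1) st') {s. \<not> (\<psi> b \<in> verts (fst s))} \<le> (r - 1) * miss"
        by (simp add: achieves_def)
      moreover have "measure_pmf.prob (run G k (r - 1) st') {s. \<not> (\<psi> ` A \<subseteq> verts (fst s) \<and> \<psi> b \<in> verts (fst s))}
          \<le> measure_pmf.prob (run G k (r - 1) st') {s. \<not> (\<psi> b \<in> verts (fst s))}"
      proof (rule measure_pmf.finite_measure_mono_AE, rule AE_pmfI)
        fix s assume "s \<in> set_pmf (run G k (r - 1) st')"
        from run_support[OF finite_verts this st'(1)] st'(2) found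
        show "s \<in> {s. \<not> (\<psi> ` A \<subseteq> verts (fst s) \<and> \<psi> b \<in> verts (fst s))} \<longrightarrow> s \<in> {s. \<not> (\<psi> b \<in> verts (fst s))}"
          unfolding extends_def by blast
      qed simp
      ultimately show "achieves G k (r - 1) ((r - 1) * miss) (\<lambda>s. \<psi> ` A \<subseteq> verts (fst s) \<and> \<psi> b \<in> verts (fst s)) st'"
        by (simp add: achieves_def)
    qed (use miss_nonneg in simp)
    moreover have "1 + (r - 1) = r" "miss + (r - 1) * miss = r * miss"
      using r_pos by (auto simp: algebra_simps of_nat_diff)
    ultimately have "achieves G k r (r * miss) (\<lambda>s. \<psi> ` A \<subseteq> verts (fst s) \<and> \<psi> b \<in> verts (fst s)) st"
      by simp
    thus ?thesis
      by (rule achieves_weaken) (use emb ab(2) in \<open>auto simp: partial_def\<close>)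
  next
    case False
    from many_extensions[OF emb A] False obtain a b X where X: "a \<in> A" "b \<in> verts H - A"
      "X \<subseteq> neighbours G (\<psi> a)" "X \<noteq> {}" "deg (\<psi> a) \<le> \<delta> * card X"
      "\<forall>x\<in>X. \<exists>\<psi>'. embedding H E' \<psi>' \<and> (\<forall>u\<in>A. \<psi>' u = \<psi> u) \<and> \<psi>' b = x" by blast
    have "\<psi> a \<in> verts (fst st)" using X(1) found by blast
    from miss_round[OF finite_verts X(3-5) assms(4) this]
    have "achieves G k 1 miss (hit (\<psi> a) X) st" unfolding achieves_def miss_def .
    hence "achieves G k (1 + (r - 1)) (miss + (r - 1) * miss) (\<lambda>s. \<exists>b\<in>verts H - A. partial (insert b A) s) st"
    proof (rule achieves_seq[OF finite_verts _ assms(4)])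
      fix st' assume st': "valid_state G st'" "extends st st'" "hit (\<psi> a) X st'"
      then obtain x where x: "x \<in> X" "x \<in> verts (fst st')" by (auto simp: hit_def)
      with X(6) obtain \<psi>' where "embedding H E' \<psi>'" "\<forall>u\<in>A. \<psi>' u = \<psi> u" "\<psi>' b = x"
        by blast
      moreover have "\<psi> ` A \<subseteq> verts (fst st')" using found st'(2) by (auto simp: extends_def)
      ultimately have "partial (insert b A) st'" using x(2) unfolding partial_def
        by (intro exI[of _ \<psi>']) auto
      thus "achieves G k (r - 1) ((r - 1) * miss) (\<lambda>s. \<exists>b\<in>verts H - A. partial (insert b A) s) st'"
        using X(2) st'(1) partial_extends miss_nonneg
        by (intro achieves_holds finite_verts) (blast | simp)+
    qed (use miss_nonneg in simp)
    moreover have "1 + (r - 1) = r" "miss + (r - 1) * miss = r * miss"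
      using r_pos by (auto simp: algebra_simps of_nat_diff)
    ultimately show ?thesis by simp
  qed
qed

lemma achieves_vertices:
  assumes "A \<subseteq> verts H" "A \<noteq> {}" "card (verts H) \<le> card A + j" "valid_state G st" "partial A st"
  shows "achieves G k (r * j) (r * j * miss) (partial (verts H)) st"
  using assms
proof (induction j arbitrary: A st)
  case 0
  hence "A = verts H" using card_seteq[OF finite_H] by simp
  thus ?case using 0 partial_extends by (intro achieves_holds finite_verts) auto
next
  case (Suc j)
  show ?case
  proof (cases "A = verts H")
    case True
    thus ?thesis using Suc.prems partial_extends miss_nonneg by (intro achieves_holds finite_verts) auto
  next
    case False
    have "achieves G k (r + r * j) (r * miss + r * j * miss) (partial (verts H)) st"
    proof (rule achieves_seq[OF finite_verts achieves_larger[OF Suc.prems(1,2) False Suc.prems(4,5)] Suc.prems(4)])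
      fix st' assume st': "valid_state G st'" "\<exists>b\<in>verts H - A. partial (insert b A) st'"
      then obtain b where b: "b \<in> verts H - A" "partial (insert b A) st'" by blast
      have "finite A" using Suc.prems(1) finite_H finite_subset by blast
      thus "achieves G k (r * j) (r * j * miss) (partial (verts H)) st'"
        using Suc.IH[of "insert b A" st'] Suc.prems b st'(1) by auto
    qed (use miss_nonneg in simp)
    thus ?thesis by (simp add: algebra_simps)
  qed
qed

lemma card_edges_H: "card (edges H) \<le> r ^ 2"
proof -
  have "edges H \<subseteq> (\<lambda>(u, v). {u, v}) ` (verts H \<times> verts H)"
  proof
    fix e assume "e \<in> edges H"
    then obtain u v where "e = {u, v}" "u \<in> verts H" "v \<in> verts H"
      by (rule edge_endpoints[OF H(1)])
    thus "e \<in> (\<lambda>(u, v). {u, v}) ` (verts H \<times> verts H)" by (intro image_eqI[of _ _ "(u, v)"]) auto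
  qed
  hence "card (edges H) \<le> card ((\<lambda>(u, v). {u, v}) ` (verts H \<times> verts H))"
    by (intro card_mono finite_imageI finite_cartesian_product finite_H)
  also have "\<dots> \<le> card (verts H \<times> verts H)"
    by (intro card_image_le finite_cartesian_product finite_H)
  also have "\<dots> \<le> r * r" using H(3) by (simp add: card_cartesian_product mult_le_mono)
  finally show ?thesis by (simp add: power2_eq_square)
qed

text \<open>From the upper end of a surviving edge the lower end is weakly reachable, and it is the
  only element of \<open>steps\<close> when no step remains. The pruning rule thus bounds the degree
  of the upper end by \<open>\<delta>\<close>, so queries there are likely to reveal the edge. A
  union bound over the at most \<open>r ^ 2\<close> edges finishes.\<close>

lemma achieves_edges:
  assumes "valid_state G st" "partial (verts H) st"
  shows "achieves G k 1 (r ^ 2 * miss) (\<lambda>s. contains_copy H (fst s)) st"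
proof -
  obtain \<psi> where emb: "embedding H E' \<psi>" and found: "\<psi> ` verts H \<subseteq> verts (fst st)"
    using assms(2) by (auto simp: partial_def)
  let ?P = "\<lambda>S. measure_pmf.prob (run G k 1 st) S"
  have finEH: "finite (edges H)"
    by (rule finite_subset[of _ "Pow (verts H)"]) (use H(1) finite_H in \<open>auto simp: simple_graph_def\<close>)
  have edge: "?P {s. \<psi> ` e \<notin> edges (fst s)} \<le> miss" if "e \<in> edges H" for e
  proof -
    have oriented: "?P {s. {\<psi> u, \<psi> v} \<notin> edges (fst s)} \<le> miss"
      if uv: "{u, v} \<in> edges H" "rk (\<psi> u) < rk (\<psi> v)" for u v
    proof -
      have e: "{\<psi> v, \<psi> u} \<in> E'" using embedding_edge[OF emb uv(1)] by (simp add: insert_commute)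
      have st: "steps E' (\<psi> v) (\<psi> u) 0 = {\<psi> u}" using e by (auto simp: steps_def)
      have "\<psi> v \<in> reach rk E' (\<psi> u) (Suc 0)" using e uv by simp
      hence "\<psi> v \<in> reach rk E (\<psi> u) r" by (rule reachD_mono) (use r_pos E'_sub in auto)
      hence "\<psi> u \<in> Z (\<psi> v) \<union> C (\<psi> v)" by (simp add: C_def)
      moreover have "\<psi> v \<in> verts (fst st)" using found simple_edge[OF H(1) uv(1)] by auto
      ultimately have "achieves G k 1 miss (hit (\<psi> v) {\<psi> u}) st"
        using achieves_steps[OF assms(1), of "\<psi> v" "\<psi> u" 0] r_pos st by simp
      hence "?P {s. \<not> hit (\<psi> v) {\<psi> u} s} \<le> miss" by (simp add: achieves_def)
      moreover have "?P {s. {\<psi> u, \<psi> v} \<notin> edges (fst s)} \<le> ?P {s. \<not> hit (\<psi> v) {\<psi> u} s}"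
        by (rule measure_pmf.finite_measure_mono) (auto simp: hit_def insert_commute)
      ultimately show ?thesis by linarith
    qed
    obtain u v where uv: "e = {u, v}" by (rule edge_endpoints[OF H(1) \<open>e \<in> edges H\<close>])
    have "{\<psi> u, \<psi> v} \<in> E" using embedding_edge[OF emb] that uv E'_sub by auto
    hence "rk (\<psi> u) \<noteq> rk (\<psi> v)" using simple_edge[OF simple] inj_onD[OF rk_inj] by blast
    hence "rk (\<psi> u) < rk (\<psi> v) \<or> rk (\<psi> v) < rk (\<psi> u)" by auto
    thus ?thesis using oriented[of u v] oriented[of v u] that uv by (auto simp: insert_commute)
  qed
  have "?P {s. \<not> contains_copy H (fst s)} \<le> ?P (\<Union>e\<in>edges H. {s. \<psi> ` e \<notin> edges (fst s)})"
  proof (rule measure_pmf.finite_measure_mono_AE, rule AE_pmfI)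
    fix s assume "s \<in> set_pmf (run G k 1 st)"
    from run_support[OF finite_verts this assms(1)] have "\<psi> ` verts H \<subseteq> verts (fst s)"
      using found by (auto simp: extends_def)
    thus "s \<in> {s. \<not> contains_copy H (fst s)} \<longrightarrow> s \<in> (\<Union>e\<in>edges H. {s. \<psi> ` e \<notin> edges (fst s)})"
      using contains_copyI[OF H(1), of \<psi> "fst s"] emb by (auto simp: embedding_def)
  qed simp
  also have "\<dots> \<le> (\<Sum>e\<in>edges H. ?P {s. \<psi> ` e \<notin> edges (fst s)})"
    by (rule measure_pmf.finite_measure_subadditive_finite) (use finEH in auto)
  also have "\<dots> \<le> (\<Sum>e\<in>edges H. miss)" by (rule sum_mono) (rule edge)
  also have "\<dots> \<le> real (r ^ 2) * miss"
    using card_edges_H miss_nonneg unfolding sum_constant by (intro mult_right_mono of_nat_mono)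
  finally show ?thesis by (simp add: achieves_def)
qed

lemma achieves_copy:
  assumes "valid_state G st" "embedding H E' \<psi>" "v \<in> \<psi> ` verts H" "v \<in> verts (fst st)" "s \<ge> r * (r - 1) + 1"
  shows "achieves G k s (2 * r ^ 2 * miss) (\<lambda>s. contains_copy H (fst s)) st"
proof -
  obtain u where u: "u \<in> verts H" "v = \<psi> u" using assms(3) by blast
  have "partial {u} st" using assms(2,4) u by (auto simp: partial_def)
  hence "achieves G k (r * (r - 1)) (r * (r - 1) * miss) (partial (verts H)) st"
    using achieves_vertices[of "{u}" "r - 1"] u H(3) r_pos assms(1) by simp
  hence "achieves G k (r * (r - 1) + 1) (r * (r - 1) * miss + r ^ 2 * miss) (\<lambda>s. contains_copy H (fst s)) st"
    by (rule achieves_seq[OF finite_verts _ assms(1)]) (use achieves_edges miss_nonneg in auto)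
  thus ?thesis
  proof (rule achieves_pad[OF finite_verts _ assms(1,5)])
    have "r * (r - 1) \<le> r * r" by simp
    hence "real (r * (r - 1)) * miss \<le> real (r * r) * miss"
      by (intro mult_right_mono of_nat_mono miss_nonneg)
    thus "real (r * (r - 1)) * miss + real (r ^ 2) * miss \<le> real (2 * r ^ 2) * miss"
      by (simp add: power2_eq_square)
  qed (auto simp: extends_def intro: contains_copy_mono)
qed

end

section \<open>The tester\<close>

context pattern_graph
begin

text \<open>Only edges leading downwards from \<open>B\<close> are taken; all edges at
  \<open>B\<close> could be too many, as \<open>B\<close> may contain vertices of large
  degree.\<close>

lemma upper_edges:
  assumes "B \<subseteq> V"
  defines "U \<equiv> \<Union>v\<in>B. (\<lambda>u. {v, u}) ` back_neighbours rk G v"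
  shows "finite U" "card U \<le> p * card B"
proof -
  have B: "finite B" using assms(1) finite_verts finite_subset by blast
  have fb: "finite (back_neighbours rk G v)" for v
    using finite_neighbours by (simp add: back_neighbours_def)
  show "finite U" unfolding U_def using B fb by blast
  have "card U \<le> (\<Sum>v\<in>B. card ((\<lambda>u. {v, u}) ` back_neighbours rk G v))"
    unfolding U_def by (rule card_UN_le[OF B])
  also have "\<dots> \<le> (\<Sum>v\<in>B. p)"
  proof (rule sum_mono)
    fix v assume "v \<in> B"
    thus "card ((\<lambda>u. {v, u}) ` back_neighbours rk G v) \<le> p"
      using card_image_le[OF fb, of "\<lambda>u. {v, u}" v] card_back_neighbours[of v] assms(1) by fastforce
  qed
  finally show "card U \<le> p * card B" by (simp add: mult.commute)
qed

lemma upper_end: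
  assumes "{u, v} \<in> E"
  shows "\<exists>w\<in>{u, v}. {u, v} \<in> (\<lambda>x. {w, x}) ` back_neighbours rk G w"
proof -
  have uv: "u \<in> V" "v \<in> V" "u \<noteq> v" using simple_edge[OF simple assms] by auto
  hence "rk u \<noteq> rk v" using inj_onD[OF rk_inj] by blast
  hence "u \<in> back_neighbours rk G v \<or> v \<in> back_neighbours rk G u"
    using assms uv by (auto simp: back_neighbours_def neighbours_def insert_commute)
  thus ?thesis by (auto simp: insert_commute)
qed

text \<open>Both ends of an edge of a copy in \<open>E'\<close> lie in \<open>B\<close>, in
  particular the upper one, so deleting \<open>U\<close> destroys all copies. This and the pruning
  change at most \<open>\<epsilon> / 2 * card V + p * card B\<close> edges, and being far from free
  forces \<open>B\<close> to be large.\<close>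

lemma many_copy_vertices:
  assumes far: "far_from_free \<epsilon> H G" and E': "E' \<subseteq> E" "real (card (E - E')) \<le> \<epsilon> / 2 * card V"
  shows "\<epsilon> * card V \<le> 2 * p * card {v \<in> V. \<exists>\<psi>. embedding H E' \<psi> \<and> v \<in> \<psi> ` verts H}"
proof -
  define B where "B = {v \<in> V. \<exists>\<psi>. embedding H E' \<psi> \<and> v \<in> \<psi> ` verts H}"
  define U where "U = (\<Union>v\<in>B. (\<lambda>u. {v, u}) ` back_neighbours rk G v)"
  define G' where "G' = UGraph V (E' - U)"
  have BV: "B \<subseteq> V" by (auto simp: B_def)
  note U = upper_edges[OF BV, folded U_def]
  have "simple_graph G'"
    using simple E' by (auto simp: simple_graph_def G'_def)
  moreover have "free_of H G'"
    unfolding free_of_def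
  proof
    assume "contains_copy H G'"
    then obtain \<psi> where \<psi>: "embedding H (E' - U) \<psi>"
      using contains_copyD[OF H(1)] by (fastforce simp: G'_def)
    hence emb: "embedding H E' \<psi>" by (auto simp: embedding_def)
    have "verts H \<noteq> {}" using H(4) by auto
    then obtain u v where uv: "{u, v} \<in> edges H" using edge_at_vertex by blast
    note uvV = simple_edge[OF H(1) uv]
    have e: "{\<psi> u, \<psi> v} \<in> E' - U" using \<psi> uv unfolding embedding_def by force
    hence "{\<psi> u, \<psi> v} \<in> E" using E' by auto
    moreover from this have "\<psi> u \<in> B" "\<psi> v \<in> B"
      using emb uvV simple_edge[OF simple] by (auto simp: B_def)
    ultimately have "{\<psi> u, \<psi> v} \<in> U" using upper_end by (fastforce simp: U_def)
    thus False using e by simp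
  qed
  moreover have "verts G' = V" by (simp add: G'_def)
  ultimately have "\<epsilon> * card V \<le> card ((E - edges G') \<union> (edges G' - E))"
    using far unfolding far_from_free_def by blast
  also have "(E - edges G') \<union> (edges G' - E) \<subseteq> (E - E') \<union> U" using E' by (auto simp: G'_def)
  hence "card ((E - edges G') \<union> (edges G' - E)) \<le> card ((E - E') \<union> U)"
    using finite_E U by (intro card_mono) auto
  also have "card ((E - E') \<union> U) \<le> card (E - E') + card U" by (rule card_Un_le)
  also have "real (card (E - E') + card U) \<le> \<epsilon> / 2 * card V + p * card B"
    using E'(2) U(2) by (metis add_mono of_nat_add of_nat_mono of_nat_mult)
  finally have "\<epsilon> * card V \<le> \<epsilon> / 2 * card V + p * card B" by simp
  thus ?thesis by (simp add: B_def field_simps)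
qed

text \<open>The preceding count without any pruning. The bound allows factors
  \<open>\<epsilon>\<close> to be traded for factors \<open>p\<close> when constants are
  compared.\<close>

lemma far_epsilon:
  assumes "far_from_free \<epsilon> H G" "V \<noteq> {}"
  shows "\<epsilon> \<le> 2 * p"
proof -
  have "real (card V) > 0" using assms(2) finite_verts by (simp add: card_gt_0_iff)
  moreover have "card {v \<in> V. \<exists>\<psi>. embedding H E \<psi> \<and> v \<in> \<psi> ` verts H} \<le> card V"
    by (rule card_mono[OF finite_verts]) auto
  moreover have "\<epsilon> * card V \<le> 2 * p * card {v \<in> V. \<exists>\<psi>. embedding H E \<psi> \<and> v \<in> \<psi> ` verts H}"
    using many_copy_vertices[OF assms(1), of E] eps_pos by simp
  moreover from calculation(2) have "real (2 * p * card {v \<in> V. \<exists>\<psi>. embedding H E \<psi> \<and> v \<in> \<psi> ` verts H}) \<le> real (2 * p * card V)"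
    by (intro of_nat_mono mult_left_mono) auto
  ultimately have "\<epsilon> * card V \<le> 2 * p * card V" by linarith
  thus ?thesis using \<open>real (card V) > 0\<close> by simp
qed

end

section \<open>Comparison with the prescribed constants\<close>

lemma beta_power_bounds:
  fixes p r :: nat
  assumes "2 \<le> p" "2 \<le> r"
  defines "w \<equiv> real p powr (16 * real r ^ 2 * log 2 (real r))"
  shows "real p ^ (16 * r ^ 2) \<le> w" "real r ^ (16 * r ^ 2) \<le> w"
proof -
  have lr: "1 \<le> log 2 (real r)" using assms by simp
  have "real p ^ (16 * r ^ 2) = real p powr (16 * real r ^ 2)"
    using powr_realpow[of "real p" "16 * r ^ 2"] assms by simp
  also have "\<dots> \<le> w"
    unfolding w_def using assms lr by (intro powr_mono) (auto simp: mult_le_cancel_left1)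
  finally show "real p ^ (16 * r ^ 2) \<le> w" .
  \<comment> \<open>The logarithm in the exponent makes this work: \<open>p\<close> is at least 2,
    and \<open>2 powr log 2 r\<close> equals \<open>r\<close>.\<close>
  have "real r ^ (16 * r ^ 2) = (2 powr log 2 (real r)) powr (16 * real r ^ 2)"
    using powr_realpow[of "real r" "16 * r ^ 2"] assms by simp
  also have "\<dots> = 2 powr (16 * real r ^ 2 * log 2 (real r))" by (simp add: powr_powr mult.commute)
  also have "\<dots> \<le> w" unfolding w_def using assms lr by (intro powr_mono2) auto
  finally show "real r ^ (16 * r ^ 2) \<le> w" .
qed

text \<open>In terms of \<open>w\<close> the prescribed value is
  \<open>2 ^ 24 * r * w ^ 3 / \<epsilon> ^ 3\<close>, while the pruning requires at most
  \<open>256 * p ^ 2 * r ^ 3 * 2 ^ r * c ^ (r + 2) / \<epsilon> ^ 2\<close>. One factor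
  \<open>w\<close> takes in the powers of \<open>p\<close>, another the powers of \<open>r\<close>,
  and the third is slack.\<close>

lemma delta_bound:
  fixes p r c T :: nat and \<epsilon> D D2 :: real
  assumes p: "2 \<le> p" and r: "2 \<le> r" and \<epsilon>: "0 < \<epsilon>" "\<epsilon> \<le> 2 * p"
  defines "c \<equiv> (1 + p * r) ^ r"
  defines "T \<equiv> 2 ^ r * c ^ r * r"
  defines "D2 \<equiv> 8 * p * T / \<epsilon>"
  defines "D \<equiv> 2 * r * c * D2"
  shows "8 * p * r * c * (D + 1) / \<epsilon> \<le> delta_par p r \<epsilon>" "2 * D2 \<le> delta_par p r \<epsilon>" "1 \<le> delta_par p r \<epsilon>"
proof -
  define w where "w = real p powr (16 * real r ^ 2 * log 2 (real r))"
  note w = beta_power_bounds[OF p r, folded w_def]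
  have c1: "1 \<le> c" by (simp add: c_def)
  have T1: "1 \<le> T" using c1 r by (simp add: T_def Suc_leI)
  have pT: "real p \<le> p * T" using mult_le_mono2[OF T1, of p] by (metis mult_1_right of_nat_mono of_nat_mult)
  have D2_ge: "4 \<le> D2"
  proof -
    have "4 * \<epsilon> \<le> 8 * real (p * T)" using pT \<epsilon> by linarith
    thus ?thesis using \<epsilon> by (simp add: D2_def field_simps)
  qed
  have "2 * 1 \<le> r * c" using r c1 by (rule mult_le_mono)
  hence "2 * real (2::nat) \<le> 2 * real (r * c)" by linarith
  hence D_ge: "4 * D2 \<le> D" using D2_ge unfolding D_def by (intro mult_right_mono) auto
  have D1: "1 \<le> D" using D_ge D2_ge by linarith
  define X where "X = 8 * p * r * c * (D + 1) / \<epsilon>"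
  have X_ge: "D \<le> X"
  proof -
    have "1 * 1 \<le> r * c" using r c1 by (intro mult_le_mono) auto
    hence "p * 1 \<le> p * (r * c)" by (intro mult_le_mono) auto
    hence "real p \<le> real (p * (r * c))" by (simp only: of_nat_le_iff mult_1_right)
    hence "\<epsilon> \<le> 8 * real (p * (r * c))" using \<epsilon> by linarith
    hence "\<epsilon> \<le> 8 * p * r * c" by (simp add: mult_ac)
    hence "\<epsilon> * D \<le> 8 * p * r * c * (D + 1)" using D1 \<epsilon> by (intro mult_mono) auto
    thus ?thesis using \<epsilon> by (simp add: X_def field_simps)
  qed
  have c_le: "c \<le> (p ^ 2 * r) ^ r"
  proof -
    have "1 + p * r \<le> 2 * (p * r)" using p r by simp
    also have "\<dots> \<le> p * (p * r)" using p by (rule mult_le_mono1)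
    finally show ?thesis unfolding c_def by (intro power_mono) (simp_all add: power2_eq_square mult.assoc)
  qed
  have nat_bound: "p ^ 3 * r ^ 2 * 2 ^ r * c ^ (r + 2) \<le> p ^ (16 * r ^ 2) * r ^ (16 * r ^ 2)"
  proof -
    have r2: "2 * r \<le> r ^ 2" using r by (simp add: power2_eq_square)
    have "c ^ (r + 2) \<le> ((p ^ 2 * r) ^ r) ^ (r + 2)" by (rule power_mono[OF c_le]) simp
    also have "\<dots> = (p ^ 2 * r) ^ (r * (r + 2))" by (simp only: power_mult)
    also have "\<dots> \<le> (p ^ 2 * r) ^ (2 * r ^ 2)"
    proof (rule power_increasing)
      have "r * (r + 2) = r ^ 2 + 2 * r" by (simp add: power2_eq_square algebra_simps)
      thus "r * (r + 2) \<le> 2 * r ^ 2" using r2 by linarith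
      show "1 \<le> p ^ 2 * r" using p r by (simp add: Suc_leI)
    qed
    also have "\<dots> = p ^ (4 * r ^ 2) * r ^ (2 * r ^ 2)"
      by (simp add: power_mult_distrib flip: power_mult)
    finally have 1: "c ^ (r + 2) \<le> p ^ (4 * r ^ 2) * r ^ (2 * r ^ 2)" .
    have 2: "2 ^ r \<le> p ^ r" using p by (rule power_mono) simp
    have "p ^ 3 * r ^ 2 * 2 ^ r * c ^ (r + 2) \<le> p ^ 3 * r ^ 2 * p ^ r * (p ^ (4 * r ^ 2) * r ^ (2 * r ^ 2))"
      using 1 2 by (intro mult_le_mono) auto
    also have "\<dots> = p ^ (3 + r + 4 * r ^ 2) * r ^ (2 + 2 * r ^ 2)"
      by (simp only: power_add mult_ac)
    also have "\<dots> \<le> p ^ (16 * r ^ 2) * r ^ (16 * r ^ 2)"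
      using p r r2 by (intro mult_le_mono power_increasing) auto
    finally show ?thesis .
  qed
  have w1: "1 \<le> w"
    by (rule order_trans[OF _ w(1)]) (use p in simp)
  have "real (p ^ 3 * r ^ 2 * 2 ^ r * c ^ (r + 2)) \<le> real (p ^ (16 * r ^ 2) * r ^ (16 * r ^ 2))"
    using nat_bound by (rule of_nat_mono)
  also have "\<dots> = real p ^ (16 * r ^ 2) * real r ^ (16 * r ^ 2)" by simp
  also have "\<dots> \<le> w * w" using w w1 by (intro mult_mono) auto
  also have "\<dots> \<le> w * w * w" using w1 by (simp add: mult_le_cancel_left1)
  finally have main: "real (p ^ 3 * r ^ 2 * 2 ^ r * c ^ (r + 2)) \<le> w ^ 3"
    by (simp add: power3_eq_cube)
  have "X \<le> 8 * p * r * c * (2 * D) / \<epsilon>"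
    unfolding X_def using D1 \<epsilon> by (intro divide_right_mono mult_left_mono) auto
  also have "\<dots> = 256 * real (p ^ 2 * r ^ 3 * 2 ^ r * c ^ (r + 2)) / \<epsilon> ^ 2"
    using \<epsilon> by (simp add: D_def D2_def T_def power_add field_simps power2_eq_square power3_eq_cube)
  \<comment> \<open>A factor \<open>p\<close> is added above and below, because
    \<open>\<epsilon> \<le> 2 * p\<close> then turns \<open>p * \<epsilon> ^ 2\<close> into
    \<open>\<epsilon> ^ 3\<close> up to a constant.\<close>
  also have "\<dots> = 256 * real r * real (p ^ 3 * r ^ 2 * 2 ^ r * c ^ (r + 2)) / (p * \<epsilon> ^ 2)"
    using p \<epsilon> by (simp add: field_simps power2_eq_square power3_eq_cube)
  also have "\<dots> \<le> 256 * real r * w ^ 3 / (p * \<epsilon> ^ 2)"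
    using main p \<epsilon> by (intro divide_right_mono mult_left_mono) auto
  also have "\<dots> \<le> 2 ^ 24 * real r * w ^ 3 / \<epsilon> ^ 3"
  proof -
    have "\<epsilon> ^ 3 \<le> 2 * (p * \<epsilon> ^ 2)"
      using mult_right_mono[OF \<epsilon>(2), of "\<epsilon> ^ 2"] by (simp add: power2_eq_square power3_eq_cube)
    moreover have "0 \<le> p * \<epsilon> ^ 2" by simp
    ultimately have "256 * \<epsilon> ^ 3 \<le> 16777216 * (p * \<epsilon> ^ 2)" by linarith
    hence "256 * \<epsilon> ^ 3 \<le> 2 ^ 24 * (p * \<epsilon> ^ 2)" by simp
    hence "256 * \<epsilon> ^ 3 * (r * w ^ 3) \<le> 2 ^ 24 * (p * \<epsilon> ^ 2) * (r * w ^ 3)"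
      using w1 by (intro mult_right_mono) auto
    thus ?thesis using \<epsilon> p by (simp add: field_simps)
  qed
  also have "\<dots> = delta_par p r \<epsilon>"
    using \<epsilon> by (simp add: delta_par_def beta_par_def w_def field_simps power_mult_distrib power3_eq_cube)
  finally show X: "8 * p * r * c * (D + 1) / \<epsilon> \<le> delta_par p r \<epsilon>" by (simp add: X_def)
  thus "2 * D2 \<le> delta_par p r \<epsilon>" "1 \<le> delta_par p r \<epsilon>"
    using X_ge D_ge D2_ge D1 unfolding X_def by linarith+
qed

section \<open>Sampling, optimal orders and the final estimate\<close>

lemma prob_samples_avoid:
  "measure_pmf.prob (replicate_pmf m q) {xs. set xs \<inter> B = {}} \<le> measure_pmf.prob q (- B) ^ m"
proof (induction m)
  case (Suc m)
  have "measure_pmf.prob (q \<bind> (\<lambda>x. map_pmf ((#) x) (replicate_pmf m q))) {xs. set xs \<inter> B = {}} \<le>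
      measure_pmf.prob q (- B) ^ m * measure_pmf.prob q (- B) + 0"
  proof (rule prob_bind_le)
    fix x
    have "(#) x -` {xs. set xs \<inter> B = {}} = (if x \<in> B then {} else {xs. set xs \<inter> B = {}})" by auto
    thus "measure_pmf.prob (map_pmf ((#) x) (replicate_pmf m q)) {xs. set xs \<inter> B = {}} \<le>
        measure_pmf.prob q (- B) ^ m * indicator (- B) x + 0"
      using Suc by simp
  qed auto
  thus ?case by (simp add: map_pmf_def mult.commute)
qed simp

text \<open>The minimum over all orders is attained. The rank of a vertex is the size of its initial
  segment, which grows strictly along the order by antisymmetry.\<close>

lemma ordered_graph_of_adm:
  assumes G: "simple_graph G" "verts G \<noteq> {}" and "adm r G \<le> p" "1 \<le> r"
  shows "\<exists>R rk. ordered_graph G R rk p r"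
proof -
  have fin: "finite (verts G)" using G by (simp add: simple_graph_def)
  let ?S = "{adm_ordered r G R | R. linear_order_on (verts G) R}"
  have "finite ?S" using finite_linear_orders[OF G(1)] by (simp add: setcompr_eq_image)
  moreover have "?S \<noteq> {}" using ex_linear_order by blast
  ultimately have "adm r G \<in> ?S" unfolding adm_def by (rule Min_in)
  then obtain R where R: "linear_order_on (verts G) R" "adm_ordered r G R \<le> p"
    using assms(3) by auto
  define rk where "rk = (\<lambda>v. card {u \<in> verts G. (u, v) \<in> R})"
  have refl: "\<And>v. v \<in> verts G \<Longrightarrow> (v, v) \<in> R" and tr: "trans R" and an: "antisym R"
    and tot: "\<And>u v. u \<in> verts G \<Longrightarrow> v \<in> verts G \<Longrightarrow> (u, v) \<in> R \<or> (v, u) \<in> R"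
    using R(1) by (auto simp: order_on_defs refl_on_def total_on_def) metis
  have le: "rk u \<le> rk v" if "(u, v) \<in> R" for u v
    unfolding rk_def using fin transD[OF tr _ that] by (intro card_mono) auto
  have lt: "rk u < rk v" if "(u, v) \<in> R" "u \<noteq> v" "v \<in> verts G" for u v
  proof -
    have "{w \<in> verts G. (w, u) \<in> R} \<subset> {w \<in> verts G. (w, v) \<in> R}"
    proof
      show "{w \<in> verts G. (w, u) \<in> R} \<subseteq> {w \<in> verts G. (w, v) \<in> R}" using transD[OF tr _ that(1)] by auto
      show "{w \<in> verts G. (w, u) \<in> R} \<noteq> {w \<in> verts G. (w, v) \<in> R}"
        using refl[OF that(3)] antisymD[OF an that(1)] that(2,3) by blast
    qed
    thus ?thesis unfolding rk_def using fin by (intro psubset_card_mono) auto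
  qed
  have "ordered_graph G R rk p r"
  proof
    show "simple_graph G" "1 \<le> r" by fact+
    show iff: "(u, v) \<in> R \<longleftrightarrow> rk u \<le> rk v" if "u \<in> verts G" "v \<in> verts G" for u v
      using le[of u v] lt[of v u] tot[OF that] that refl[of u] by (cases "u = v") auto
    show "inj_on rk (verts G)"
      using antisymD[OF an] iff by (auto simp: inj_on_def)
    show "card P \<le> p" if v: "v \<in> verts G" and P: "path_packing G R r v P" for v P
    proof -
      have "finite {card P |P. path_packing G R r v P}"
        using finite_path_packings[OF G(1), of R r v] by (simp add: setcompr_eq_image)
      hence "card P \<le> pp G R r v" unfolding pp_def using P by (intro Max_ge) auto
      also have "pp G R r v \<le> adm_ordered r G R"
        unfolding adm_ordered_def using fin v by (intro Max_ge) auto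
      finally show ?thesis using R(2) by simp
    qed
  qed
  thus ?thesis by blast
qed

text \<open>The first summand stands for samples that all avoid the copies, the second for an
  exploration that loses the copy; they are at most \<open>1 / 161\<close> and
  \<open>1 / 50\<close>.\<close>

lemma failure_bound:
  fixes p r :: nat and \<epsilon> b :: real
  assumes r: "2 \<le> r" and \<epsilon>: "0 < \<epsilon>" "\<epsilon> \<le> 2 * p" and b: "\<epsilon> / (2 * p) \<le> b" "b \<le> 1" and \<delta>: "1 \<le> delta_par p r \<epsilon>"
  shows "(1 - b) ^ xi1 p \<epsilon> + 2 * r ^ 2 * (1 - 1 / delta_par p r \<epsilon>) ^ xi3 p r \<epsilon> \<le> 1 / 3"
proof -
  have pow: "(1 - x) ^ m \<le> exp (- (m * x))" if "0 \<le> x" "x \<le> 1" for x :: real and m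
  proof -
    have "(1 - x) ^ m \<le> exp (- x) ^ m"
      using that exp_ge_add_one_self[of "- x"] by (intro power_mono) auto
    thus ?thesis by (simp flip: exp_of_nat_mult)
  qed
  have inv: "exp (- x) \<le> 1 / (1 + x)" if "0 \<le> x" for x :: real
    using exp_ge_add_one_self[of x] that by (simp add: exp_minus inverse_eq_divide frac_le)
  have ppos: "0 < real p" using \<epsilon> by simp
  have "20 * alpha_par p \<epsilon> / (\<epsilon> / 2) \<le> xi1 p \<epsilon>" unfolding xi1_def by (rule real_nat_ceiling_ge)
  hence "640 * p ^ 2 / \<epsilon> ^ 2 \<le> xi1 p \<epsilon>"
    by (simp add: alpha_par_def power2_eq_square field_simps)
  hence "(640 * p ^ 2 / \<epsilon> ^ 2) * (\<epsilon> / (2 * p)) \<le> xi1 p \<epsilon> * b"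
    using b \<epsilon> ppos by (intro mult_mono) auto
  moreover have "(640 * p ^ 2 / \<epsilon> ^ 2) * (\<epsilon> / (2 * p)) = 320 * (p / \<epsilon>)"
    using \<epsilon> ppos by (simp add: field_simps power2_eq_square)
  moreover have "1 / 2 \<le> p / \<epsilon>" using \<epsilon> by (simp add: field_simps)
  ultimately have "160 \<le> xi1 p \<epsilon> * b" by linarith
  moreover have "0 \<le> b" using b \<epsilon> ppos by (meson divide_nonneg_nonneg less_imp_le mult_nonneg_nonneg order_trans zero_le_numeral)
  ultimately have "(1 - b) ^ xi1 p \<epsilon> \<le> exp (- 160)"
    using pow[of b "xi1 p \<epsilon>"] b by (meson exp_le_cancel_iff neg_le_iff_le order_trans)
  hence 1: "(1 - b) ^ xi1 p \<epsilon> \<le> 1 / 161" using inv[of 160] by simp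
  let ?d = "delta_par p r \<epsilon>"
  have "20 * real r * ?d \<le> xi3 p r \<epsilon>" unfolding xi3_def by (rule real_nat_ceiling_ge)
  hence "20 * r \<le> xi3 p r \<epsilon> * (1 / ?d)" using \<delta> by (simp add: field_simps)
  hence "exp (- (xi3 p r \<epsilon> * (1 / ?d))) \<le> exp (- (20 * real r))" by simp
  moreover have "(1 - 1 / ?d) ^ xi3 p r \<epsilon> \<le> exp (- (xi3 p r \<epsilon> * (1 / ?d)))"
    by (rule pow) (use \<delta> in auto)
  ultimately have "(1 - 1 / ?d) ^ xi3 p r \<epsilon> \<le> exp (- (20 * real r))" by linarith
  \<comment> \<open>Writing the exponential as a square yields the factor
    \<open>1 / (10 * r) ^ 2\<close>, which cancels \<open>r ^ 2\<close>.\<close>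
  also have "\<dots> = exp (- (10 * real r)) ^ 2" by (simp add: power2_eq_square flip: exp_add)
  also have "\<dots> \<le> (1 / (1 + 10 * real r)) ^ 2" by (intro power_mono inv) auto
  also have "\<dots> \<le> (1 / (10 * real r)) ^ 2" using r by (intro power_mono divide_left_mono) auto
  finally have "2 * r ^ 2 * (1 - 1 / ?d) ^ xi3 p r \<epsilon> \<le> 2 * r ^ 2 * (1 / (10 * real r)) ^ 2"
    by (rule mult_left_mono) simp
  also have "\<dots> = 1 / 50" using r by (simp add: power2_eq_square)
  finally show ?thesis using 1 by linarith
qed

definition verdict_on :: "'b ugraph \<Rightarrow> nat ugraph \<times> nat \<Rightarrow> (verdict \<times> nat) pmf" where
  "verdict_on H = (\<lambda>(K, q). return_pmf (if contains_copy H K then Reject else Accept, q))"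

lemma tester_alt:
  "tester p r H \<epsilon> n (random_neighbour_oracle G) =
     replicate_pmf (xi1 p \<epsilon>) (pmf_of_set {1..n}) \<bind>
       (\<lambda>xs. run G (xi3 p r \<epsilon>) (xi2 r) (UGraph (set xs) {}, 0) \<bind> verdict_on H)"
  by (simp add: tester_def verdict_on_def)

lemma samples_valid:
  fixes G :: "nat ugraph"
  assumes "xs \<in> set_pmf (replicate_pmf m (pmf_of_set {1..n}))" "n > 0" "verts G = {1..n}"
  shows "valid_state G (UGraph (set xs) {}, 0)" "card (set xs) \<le> m"
proof -
  have "set_pmf (pmf_of_set {1..n}) = {1..n}" using assms(2) by (intro set_pmf_of_set) auto
  with assms(1) have "set xs \<subseteq> {1..n}" "length xs = m" by (auto simp: set_replicate_pmf lists_eq_set)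
  thus "valid_state G (UGraph (set xs) {}, 0)" "card (set xs) \<le> m"
    using assms(3) card_length[of xs] by (simp_all add: valid_state_def)
qed

text \<open>Acceptance requires one of two failures: no sample lies on a copy in the pruned graph,
  or the exploration starting from such a sample finds no copy.\<close>

lemma rejection_probability:
  fixes H :: "'b ugraph" and G :: "nat ugraph"
  assumes p: "p \<ge> 2" and H: "simple_graph H" "connected_graph H" "card (verts H) \<ge> 2" "card (verts H) \<le> r"
    and \<epsilon>: "\<epsilon> > 0"
    and G: "simple_graph G" "verts G = {1..n}" "n > 2 * r" "adm r G \<le> p" "far_from_free \<epsilon> H G"
  shows "2 / 3 \<le> measure_pmf.prob (tester p r H \<epsilon> n (random_neighbour_oracle G)) {(d, q). d = Reject}"
proof -
  have r: "2 \<le> r" using H by simp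
  have n: "n > 0" using G by simp
  define k where "k = xi3 p r \<epsilon>"
  define \<delta> where "\<delta> = delta_par p r \<epsilon>"
  obtain R rk where "ordered_graph G R rk p r"
    using ordered_graph_of_adm[OF G(1) _ G(4)] G(2) n r by auto
  then interpret pattern_graph G R rk p r H \<epsilon>
    using H p \<epsilon> by (intro pattern_graph.intro pattern_graph_axioms.intro) auto
  have eps: "\<epsilon> \<le> 2 * p" by (rule far_epsilon[OF G(5)]) (use G n in auto)
  note db = delta_bound[OF p r \<epsilon> eps]
  have d: "8 * p * r * c * (D + 1) / \<epsilon> \<le> \<delta>" "2 * D2 \<le> \<delta>" "1 \<le> \<delta>"
    using db unfolding \<delta>_def D_def D2_def T_def c_def by simp_all
  from pruned_edges[OF d(1)] obtain E' where E': "E' \<subseteq> E" "real (card (E - E')) \<le> \<epsilon> / 2 * card V"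
    "\<forall>h\<in>V. \<forall>m\<in>Z h \<union> C h. \<forall>l<r. steps E' h m l \<noteq> {} \<longrightarrow> deg h \<le> \<delta> * card (steps E' h m l)"
    "\<forall>h\<in>V. \<forall>(K, \<phi>, k0)\<in>patterns h. extensions E' h K \<phi> k0 \<noteq> {} \<longrightarrow>
        deg h \<le> D2 * card (extensions E' h K \<phi> k0)"
    by (elim exE conjE) (rule that)
  interpret explored_graph G R rk p r H \<epsilon> \<delta> E' k
    by unfold_locales (use E' d in fast)+
  define B where "B = {v \<in> V. \<exists>\<psi>. embedding H E' \<psi> \<and> v \<in> \<psi> ` verts H}"
  have BV: "B \<subseteq> V" by (auto simp: B_def)
  define b where "b = card B / n"
  have cV: "card V = n" using G by simp
  have cB: "card B \<le> n" using card_mono[OF finite_verts BV] cV by simp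
  have "\<epsilon> * n \<le> 2 * p * card B" using many_copy_vertices[OF G(5) E'(1,2)] cV by (simp add: B_def)
  hence b: "\<epsilon> / (2 * p) \<le> b" "b \<le> 1" using n p cB by (auto simp: b_def field_simps)
  have "measure_pmf.prob (pmf_of_set {1..n}) (- B) = 1 - b"
  proof -
    have "measure_pmf.prob (pmf_of_set {1..n}) B = b"
      using n BV G(2) by (subst measure_pmf_of_set) (auto simp: b_def Int_absorb1)
    thus ?thesis using measure_pmf.prob_compl[of B "pmf_of_set {1..n}"] by (simp add: Compl_eq_Diff_UNIV)
  qed
  hence avoid: "measure_pmf.prob (replicate_pmf (xi1 p \<epsilon>) (pmf_of_set {1..n})) {xs. set xs \<inter> B = {}}
      \<le> (1 - b) ^ xi1 p \<epsilon>"
    using prob_samples_avoid by metis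
  let ?T = "tester p r H \<epsilon> n (random_neighbour_oracle G)"
  let ?A = "{(d, q). d = Accept} :: (verdict \<times> nat) set"
  have rounds: "r * (r - 1) + 1 \<le> xi2 r"
  proof -
    have "r * (r - 1) \<le> r ^ 2" by (simp add: power2_eq_square)
    thus ?thesis by (simp add: xi2_def)
  qed
  have "measure_pmf.prob ?T ?A \<le>
    1 * measure_pmf.prob (replicate_pmf (xi1 p \<epsilon>) (pmf_of_set {1..n})) {xs. set xs \<inter> B = {}} + 2 * r ^ 2 * miss"
    unfolding tester_alt
  proof (rule prob_bind_le)
    fix xs assume xs: "xs \<in> set_pmf (replicate_pmf (xi1 p \<epsilon>) (pmf_of_set {1..n}))"
    let ?st = "(UGraph (set xs) {}, 0) :: nat ugraph \<times> nat"
    have valid: "valid_state G ?st" by (rule samples_valid(1)[OF xs n G(2)])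
    let ?acc = "measure_pmf.prob (run G (xi3 p r \<epsilon>) (xi2 r) ?st \<bind> verdict_on H) ?A"
    show "?acc \<le> 1 * indicator {xs. set xs \<inter> B = {}} xs + 2 * r ^ 2 * miss"
    proof (cases "set xs \<inter> B = {}")
      case True
      thus ?thesis using miss_nonneg by (intro order_trans[OF measure_pmf.prob_le_1]) simp
    next
      case False
      then obtain v \<psi> where v: "v \<in> set xs" "embedding H E' \<psi>" "v \<in> \<psi> ` verts H" by (auto simp: B_def)
      have "achieves G k (xi2 r) (2 * r ^ 2 * miss) (\<lambda>s. contains_copy H (fst s)) ?st"
        by (rule achieves_copy[OF valid v(2,3) _ rounds]) (use v in simp)
      hence "measure_pmf.prob (run G k (xi2 r) ?st) {s. \<not> contains_copy H (fst s)} \<le> 2 * r ^ 2 * miss"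
        by (simp add: achieves_def)
      moreover have "?acc \<le> 1 * measure_pmf.prob (run G k (xi2 r) ?st) {s. \<not> contains_copy H (fst s)} + 0"
        unfolding k_def
      proof (rule prob_bind_le)
        fix s
        show "measure_pmf.prob (verdict_on H s) ?A \<le> 1 * indicator {s. \<not> contains_copy H (fst s)} s + 0"
          by (cases s) (auto simp: verdict_on_def indicator_def)
      qed auto
      ultimately show ?thesis using False by simp
    qed
  qed (use miss_nonneg in auto)
  also have "\<dots> \<le> (1 - b) ^ xi1 p \<epsilon> + 2 * r ^ 2 * (1 - 1 / delta_par p r \<epsilon>) ^ xi3 p r \<epsilon>"
    using avoid unfolding miss_def unfolding k_def \<delta>_def by simp
  also have "\<dots> \<le> 1 / 3"
    by (rule failure_bound[OF r \<epsilon> eps b]) (use d in \<open>simp add: \<delta>_def\<close>)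
  finally have "measure_pmf.prob ?T ?A \<le> 1 / 3" .
  moreover have "UNIV - ?A = {(d, q). d = Reject}"
    using verdict.exhaust by (auto)
  hence "measure_pmf.prob ?T {(d, q). d = Reject} = 1 - measure_pmf.prob ?T ?A"
    using measure_pmf.prob_compl[of ?A ?T] by simp
  ultimately show ?thesis by simp
qed

text \<open>Every state that can occur is contained in \<open>G\<close>, so a copy found there would
  be a copy in \<open>G\<close>.\<close>

lemma acceptance_probability:
  fixes H :: "'b ugraph" and G :: "nat ugraph"
  assumes G: "simple_graph G" "verts G = {1..n}" "n > 0" "free_of H G"
  shows "measure_pmf.prob (tester p r H \<epsilon> n (random_neighbour_oracle G)) {(d, q). d = Accept} = 1"
proof -
  have fin: "finite (verts G)" using G by simp
  have "d = Accept" if "(d, q) \<in> set_pmf (tester p r H \<epsilon> n (random_neighbour_oracle G))" for d q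
  proof -
    from that obtain xs K where xs: "xs \<in> set_pmf (replicate_pmf (xi1 p \<epsilon>) (pmf_of_set {1..n}))"
      and K: "(K, q) \<in> set_pmf (run G (xi3 p r \<epsilon>) (xi2 r) (UGraph (set xs) {}, 0))"
      and d: "d = (if contains_copy H K then Reject else Accept)"
      by (auto simp: tester_alt verdict_on_def)
    have "valid_state G (K, q)" using run_support[OF fin K samples_valid(1)[OF xs G(3,2)]] by simp
    hence "\<not> contains_copy H K"
      using G(4) contains_copy_mono[of H K G] by (auto simp: valid_state_def free_of_def)
    thus ?thesis using d by simp
  qed
  thus ?thesis by (subst measure_pmf.prob_eq_1) (auto simp: AE_measure_pmf_iff)
qed

lemma query_bound:
  assumes G: "verts G = {1..n}" "n > 0"
    and "(d, q) \<in> set_pmf (tester p r H \<epsilon> n (random_neighbour_oracle G))"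
  shows "q \<le> xi2 r * (xi1 p \<epsilon> * (xi3 p r \<epsilon> + 1) ^ xi2 r * xi3 p r \<epsilon>)"
proof -
  have fin: "finite (verts G)" using G by simp
  from assms(3) obtain xs K where xs: "xs \<in> set_pmf (replicate_pmf (xi1 p \<epsilon>) (pmf_of_set {1..n}))"
    and K: "(K, q) \<in> set_pmf (run G (xi3 p r \<epsilon>) (xi2 r) (UGraph (set xs) {}, 0))"
    by (auto simp: tester_alt verdict_on_def)
  note sv = samples_valid[OF xs G(2,1)]
  have "q \<le> xi2 r * (card (set xs) * (xi3 p r \<epsilon> + 1) ^ xi2 r * xi3 p r \<epsilon>)"
    using run_queries[OF fin K sv(1)] by simp
  also have "\<dots> \<le> xi2 r * (xi1 p \<epsilon> * (xi3 p r \<epsilon> + 1) ^ xi2 r * xi3 p r \<epsilon>)"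
    using sv(2) by (intro mult_le_mono) auto
  finally show ?thesis .
qed

theorem theorem3:
  fixes p r :: nat and H :: "'b ugraph" and \<epsilon> :: real
  assumes "p \<ge> 2"
    and "simple_graph H" and "connected_graph H"
    and "card (verts H) \<ge> 2" and "card (verts H) \<le> r"
    and "adm r H \<le> p"
    and "\<epsilon> > 0"
  shows
    "(\<forall>n (G :: nat ugraph). simple_graph G \<and> verts G = {1..n} \<and> n > 2 * r \<longrightarrow>
        (free_of H G \<longrightarrow>
           measure_pmf.prob (tester p r H \<epsilon> n (random_neighbour_oracle G))
             {(d, q). d = Accept} = 1) \<and>
        (adm r G \<le> p \<and> far_from_free \<epsilon> H G \<longrightarrow>
           measure_pmf.prob (tester p r H \<epsilon> n (random_neighbour_oracle G))
             {(d, q). d = Reject} \<ge> 2 / 3)) \<and>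
     (\<exists>Q :: nat. \<forall>n (G :: nat ugraph). simple_graph G \<and> verts G = {1..n} \<and> n > 2 * r \<longrightarrow>
        (\<forall>(d, q) \<in> set_pmf (tester p r H \<epsilon> n (random_neighbour_oracle G)). q \<le> Q))"
proof (intro conjI allI impI)
  fix n and G :: "nat ugraph"
  assume G: "simple_graph G \<and> verts G = {1..n} \<and> n > 2 * r"
  show "measure_pmf.prob (tester p r H \<epsilon> n (random_neighbour_oracle G)) {(d, q). d = Accept} = 1"
    if "free_of H G"
    using acceptance_probability[of G n H] that G by simp
  show "2 / 3 \<le> measure_pmf.prob (tester p r H \<epsilon> n (random_neighbour_oracle G)) {(d, q). d = Reject}"
    if "adm r G \<le> p \<and> far_from_free \<epsilon> H G"
    using rejection_probability[OF assms(1-5,7), of G n] that G by simp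
next
  show "\<exists>Q :: nat. \<forall>n (G :: nat ugraph). simple_graph G \<and> verts G = {1..n} \<and> n > 2 * r \<longrightarrow>
        (\<forall>(d, q) \<in> set_pmf (tester p r H \<epsilon> n (random_neighbour_oracle G)). q \<le> Q)"
    by (rule exI[of _ "xi2 r * (xi1 p \<epsilon> * (xi3 p r \<epsilon> + 1) ^ xi2 r * xi3 p r \<epsilon>)"])
      (use query_bound in fastforce)
qed

end
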